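(* For every positive integer $s$ and all positive integers $c_1,\dots,c_{2s}$, \[ \zeta(\{1\}^{c_1-1},c_2+1,\dots,\{1\}^{c_{2s-1}-1},c_{2s}+1)=Z(\mathfrak{D}(c_1,\dots,c_{2s})). \]
   Context: An index is a finite (possibly empty) tuple of positive integers; it is admissible if nonempty with last entry $\ge2$; the multiple zeta value of an admissible index $(k_1,\dots,k_r)$ is $\zeta(k_1,\dots,k_r)=\sum_{0<n_1<\cdots<n_r}n_1^{-k_1}\cdots n_r^{-k_r}$. $\{1\}^m$ denotes $m$ consecutive entries equal to $1$. Let $\mathcal{H}=\mathbb{Q}\langle x,y\rangle$ (noncommutative polynomials), $\mathcal{H}^0=\mathbb{Q}+y\mathcal{H}x$, $\mathcal{H}^{\ge2}=\mathbb{Q}+yx\,\mathbb{Q}\langle x,yx\rangle$, $e_k=yx^{k-1}$. Every word in $y\mathcal{H}x$ is uniquely $e_{k_1}\cdots e_{k_r}$ with $(k_1,\dots,k_r)$ admissible; $Z\colon\mathcal{H}^0\to\mathbb{R}$ is the $\mathbb{Q}$-linear map with $Z(1)=1$, $Z(e_{k_1}\cdots e_{k_r})=\zeta(k_1,\dots,k_r)$. Notation: $[n]=\{1,\dots,n\}$. For an index $\boldsymbol{c}=(c_1,\dots,c_r)$: $[r]^1_{\boldsymbol{c}}=\{i\in[r]:c_i=1\}$, $[r]^{>1}_{\boldsymbol{c}}=\{i\in[r]:c_i>1\}$; for $A\subset[r]$ with $[r]\setminus A=\{i_1<\dots<i_t\}$, $\boldsymbol{c}_{(-A)}=(c_{i_1},\dots,c_{i_t})$,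 and for $B\subset[r]$, $\boldsymbol{c}_{(-A)}-\boldsymbol{\delta}_B=(c_{i_1}-\delta_{i_1\in B},\dots,c_{i_t}-\delta_{i_t\in B})$ where $\delta_{i\in B}$ is $1$ if $i\in B$ and $0$ otherwise. A subset $A\subset[2s]$ is even-odd if (for even $i$, $i\in A\Rightarrow i+1\in A$) and (for odd $i$, $i\in A\Rightarrow i-1\in A$); it is odd-even if (for odd $i$, $i\in A\Rightarrow i+1\in A$) and (for even $i$, $i\in A\Rightarrow i-1\in A$). The $\mathbb{Q}$-linear map $\mathcal{D}\colon\mathcal{H}^0\to\mathcal{H}^{\ge2}$ is defined by $\mathcal{D}(1)=1$ and, writing $\mathfrak{D}(\boldsymbol{c})=\mathcal{D}(y^{c_1}x^{c_2}\cdots y^{c_{2s-1}}x^{c_{2s}})$ for an index $\boldsymbol{c}=(c_1,\dots,c_{2s})$ of even depth (with $\mathfrak{D}(\varnothing)=1$), by the recursion \begin{align*} \mathfrak{D}(\boldsymbol{c})&=\sum_{\substack{A\subset[2s]^1_{\boldsymbol{c}}\\ A\text{ even-odd}}}\ \sum_{\substack{B\subset[2s]^{>1}_{\boldsymbol{c}},\ \#A+\#B\ge1\\ \{2r,2r+1\}\not\subset B\ (r\in[s-1])}}(-1)^{\#B-1}\mathfrak{D}(\boldsymbol{c}_{(-A)}-\boldsymbol{\delta}_B)\,x^{\#A+\#B}\\ &\quad+\sum_{\substack{A\subset[2s]^1_{\boldsymbol{c}}\\ A\text{ even-odd}}}\ \sum_{\substack{B\subset[2s]^{>1}_{\boldsymbol{c}},\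 \#A+\#B\ge2\\ \{2r,2r+1\}\not\subset B\ (r\in[s-1])}}(-1)^{\#B-1}\mathfrak{D}(\boldsymbol{c}_{(-A)}-\boldsymbol{\delta}_B)\,yx^{\#A+\#B-1}\\ &\quad+\sum_{\substack{A\subset[2s]^1_{\boldsymbol{c}}\\ A\text{ odd-even}}}\ \sum_{\substack{B\subset[2s]^{>1}_{\boldsymbol{c}},\ \#A+\#B\ge2\\ \{2r-1,2r\}\not\subset B\ (r\in[s])}}(-1)^{\#B}\mathfrak{D}(\boldsymbol{c}_{(-A)}-\boldsymbol{\delta}_B)\,yx^{\#A+\#B-1}. \end{align*} (Each $\boldsymbol{c}_{(-A)}-\boldsymbol{\delta}_B$ on the right is an even-depth index of strictly smaller weight, so this determines $\mathcal{D}$.) *)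

theory Defs
  imports "HOL-Analysis.Analysis"
begin

definition mzv :: "nat list \<Rightarrow> real" where
  "mzv ks = infsum (\<lambda>ns. \<Prod>i<length ks. 1 / real (ns ! i) ^ (ks ! i))
     {ns. length ns = length ks \<and> sorted_wrt (<) ns \<and> (\<forall>n\<in>set ns. 0 < n)}"

datatype letter = X | Y

text \<open>An element of H = Q<x,y> is represented by its coefficient function on words.\<close>
type_synonym ncpoly = "letter list \<Rightarrow> rat"

definition mono :: "letter list \<Rightarrow> ncpoly" where
  "mono u = (\<lambda>w. if w = u then 1 else 0)"

definition pmult :: "ncpoly \<Rightarrow> ncpoly \<Rightarrow> ncpoly" where
  "pmult p q = (\<lambda>w. \<Sum>i\<le>length w. p (take i w) * q (drop i w))"

definition xpow :: "nat \<Rightarrow> letter list" where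
  "xpow k = replicate k X"

definition yxpow :: "nat \<Rightarrow> letter list" where
  "yxpow k = Y # replicate k X"

text \<open>Decoding a word e_{k_1}...e_{k_r} (e_k = y x^(k-1)) into its index.\<close>
function (sequential) decode :: "letter list \<Rightarrow> nat list" where
  "decode [] = []"
| "decode (X # w) = decode w"
| "decode (Y # w) = Suc (length (takeWhile (\<lambda>l. l = X) w)) # decode (dropWhile (\<lambda>l. l = X) w)"
  by pat_completeness auto
termination
  by (relation "Wellfounded.measure length") (auto simp: le_imp_less_Suc length_dropWhile_le)

text \<open>Z on words: Z(1) = 1, Z(e_{k_1}...e_{k_r}) = zeta(k_1,...,k_r) for words in yHx;
  words outside H^0 get value 0 (they never occur below).\<close>
definition Zword :: "letter list \<Rightarrow> real" where
  "Zword w = (if w = [] then 1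
              else if hd w = Y \<and> last w = X then mzv (decode w) else 0)"

definition Zpoly :: "ncpoly \<Rightarrow> real" where
  "Zpoly p = (\<Sum>w\<in>{w. p w \<noteq> 0}. real_of_rat (p w) * Zword w)"

text \<open>Positions of an index c = (c_1,...,c_n) are 1..n; c_i = c ! (i - 1).\<close>
definition ones :: "nat list \<Rightarrow> nat set" where
  "ones c = {i \<in> {1..length c}. c ! (i - 1) = 1}"

definition bigs :: "nat list \<Rightarrow> nat set" where
  "bigs c = {i \<in> {1..length c}. c ! (i - 1) > 1}"

definition even_odd :: "nat set \<Rightarrow> bool" where
  "even_odd A \<longleftrightarrow> (\<forall>i\<in>A. (even i \<longrightarrow> i + 1 \<in> A) \<and> (odd i \<longrightarrow> i - 1 \<in> A))"

definition odd_even :: "nat set \<Rightarrow> bool" where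
  "odd_even A \<longleftrightarrow> (\<forall>i\<in>A. (odd i \<longrightarrow> i + 1 \<in> A) \<and> (even i \<longrightarrow> i - 1 \<in> A))"

definition reduce :: "nat list \<Rightarrow> nat set \<Rightarrow> nat set \<Rightarrow> nat list" where
  "reduce c A B = [c ! (i - 1) - (if i \<in> B then 1 else 0). i \<leftarrow> [1..<length c + 1], i \<notin> A]"

definition noEO :: "nat list \<Rightarrow> nat set \<Rightarrow> bool" where
  "noEO c B \<longleftrightarrow> (\<forall>r\<in>{1..length c div 2 - 1}. \<not> {2*r, 2*r+1} \<subseteq> B)"

definition noOE :: "nat list \<Rightarrow> nat set \<Rightarrow> bool" where
  "noOE c B \<longleftrightarrow> (\<forall>r\<in>{1..length c div 2}. \<not> {2*r-1, 2*r} \<subseteq> B)"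

text \<open>The recursion, with a fuel argument (fuel = weight + 1 suffices, since each
  recursive call strictly decreases the weight).  Note (-1)^(#B-1) = (-1)^(#B+1).\<close>
primrec Dfuel :: "nat \<Rightarrow> nat list \<Rightarrow> ncpoly" where
  "Dfuel 0 c = (\<lambda>w. 0)"
| "Dfuel (Suc n) c = (if c = [] then mono [] else (\<lambda>w.
      (\<Sum>A\<in>{A. A \<subseteq> ones c \<and> even_odd A}.
         \<Sum>B\<in>{B. B \<subseteq> bigs c \<and> card A + card B \<ge> 1 \<and> noEO c B}.
           (-1) ^ (card B + 1) * pmult (Dfuel n (reduce c A B)) (mono (xpow (card A + card B))) w)
    + (\<Sum>A\<in>{A. A \<subseteq> ones c \<and> even_odd A}.
         \<Sum>B\<in>{B. B \<subseteq> bigs c \<and> card A + card B \<ge> 2 \<and> noEO c B}.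
           (-1) ^ (card B + 1) * pmult (Dfuel n (reduce c A B)) (mono (yxpow (card A + card B - 1))) w)
    + (\<Sum>A\<in>{A. A \<subseteq> ones c \<and> odd_even A}.
         \<Sum>B\<in>{B. B \<subseteq> bigs c \<and> card A + card B \<ge> 2 \<and> noOE c B}.
           (-1) ^ (card B) * pmult (Dfuel n (reduce c A B)) (mono (yxpow (card A + card B - 1))) w)))"

text \<open>frak D(c) = D(y^{c_1} x^{c_2} ... y^{c_{2s-1}} x^{c_{2s}}).\<close>
definition fD :: "nat list \<Rightarrow> ncpoly" where
  "fD c = Dfuel (sum_list c + 1) c"

definition lhs_index :: "nat list \<Rightarrow> nat list" where
  "lhs_index c = concat [replicate (c ! (2*j) - 1) 1 @ [c ! (2*j+1) + 1]. j \<leftarrow> [0..<length c div 2]]"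

end

theory Submission
  imports Defs
begin

text \<open>
  Discretise the iterated integral of \<open>y\<^sup>a x\<^sup>b \<dots>\<close>: sum over chains of integers in \<open>{1..N}\<close>, one per letter,
  with weight \<open>1/(N+1-m)\<close> for \<open>y\<close> and \<open>1/m\<close> for \<open>x\<close>. If all letters \<open>y\<close> sit at strictly
  increasing positions, the sum is exactly the multiple zeta value truncated at \<open>N\<close> (the formula of
  Maesaka, Seki and Watanabe). If only the steps from \<open>x\<close> to \<open>y\<close> are strict, the sum \<open>F\<^sub>N\<close>
  is symmetric enough in the two letters to satisfy

    sum over even-odd A, B of \<open>(-1)^#B F\<^sub>N (c\<^sub>-\<^sub>A - \<delta>\<^sub>B) N^(-#A-#B)\<close> =
    sum over odd-even A, B of \<open>(-1)^#B F\<^sub>N\<^sub>-\<^sub>1 (c\<^sub>-\<^sub>A - \<delta>\<^sub>B) N^(-#A-#B)\<close>.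

  Splitting off the largest summation index in the truncation at \<open>N\<close> of \<open>Z(D(c))\<close> turns the
  recursion defining \<open>D\<close> into this very identity, so \<open>F\<^sub>N(c)\<close> is that truncation. The two chain
  sums differ by \<open>O(log^k N / N)\<close>.
\<close>

text \<open>In the step from N - 1 to N the letters behave differently: an \<open>x\<close> at m
  keeps its weight 1/m, whereas a \<open>y\<close> at m + 1 now has the weight 1/(N-m) that a
  \<open>y\<close> at m had before. Shifting every \<open>y\<close> down by one makes the steps from
  \<open>x\<close> to \<open>y\<close> weak and those from \<open>y\<close> to \<open>x\<close>
  strict. What separates the two sides are thus the chains in which the letters at such a junction
  meet at one position m, and 1/(m(N-m)) = (1/N)(1/m + 1/(N-m)) expresses these by words with one
  letter fewer, at the price of 1/N: this is the lowering of entries > 1 by B. At the two ends of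
  the word, 1/N is the weight of \<open>y\<close> at 1 and of \<open>x\<close> at N. Entries 1,
  whose block would become empty, account for the deletions A. The pairs of the two sides overlap:
  cutting a pair off one side leaves half a pair on the other. Hence words ending in
  \<open>y\<close> are treated along with those ending in \<open>x\<close>, and the bound n of the
  chains is freed from N, so that the identities follow by comparing increments in n.\<close>

section \<open>The index choices of the recursion\<close>

text \<open>\<open>p = True\<close> gives the even-odd choices and \<open>p = False\<close> the odd-even ones.\<close>
definition choices :: "bool \<Rightarrow> nat list \<Rightarrow> (nat set \<times> nat set) set" where
  "choices p c = {(A, B). A \<subseteq> ones c \<and> B \<subseteq> bigs c \<and>
     (\<forall>i\<in>A. if even i = p then Suc i \<in> A else i - 1 \<in> A) \<and>
     (\<forall>i\<in>B. even i = p \<longrightarrow> Suc i \<notin> B)}"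

text \<open>The parameter h stands for 1/N. An arbitrary function on indices allows the operator to
  act on a prefix while the rest of the word is frozen inside that function.\<close>

definition choice_sum :: "bool \<Rightarrow> real \<Rightarrow> (nat list \<Rightarrow> real) \<Rightarrow> nat list \<Rightarrow> real" where
  "choice_sum p h \<phi> c =
     (\<Sum>(A, B)\<in>choices p c. (-1) ^ card B * h ^ (card A + card B) * \<phi> (reduce c A B))"

lemma ones_snoc: "ones (c @ [a]) = (if a = 1 then insert (Suc (length c)) (ones c) else ones c)"
  by (auto simp: ones_def nth_append le_Suc_eq)

lemma bigs_snoc: "bigs (c @ [a]) = (if a > 1 then insert (Suc (length c)) (bigs c) else bigs c)"
  by (auto simp: bigs_def nth_append le_Suc_eq)

lemma ones_bounds: "i \<in> ones c \<Longrightarrow> 1 \<le> i \<and> i \<le> length c"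
  and bigs_bounds: "i \<in> bigs c \<Longrightarrow> 1 \<le> i \<and> i \<le> length c"
  by (auto simp: ones_def bigs_def)

lemma choices_bounds:
  assumes "(A, B) \<in> choices p c"
  shows "A \<subseteq> {1..length c}" "B \<subseteq> {1..length c}"
  using assms ones_bounds bigs_bounds by (auto simp: choices_def subset_iff)

lemma finite_choices: "finite (choices p c)"
proof (rule finite_subset)
  show "choices p c \<subseteq> Pow {1..length c} \<times> Pow {1..length c}"
    using choices_bounds by fastforce
qed auto

lemma choices_Nil: "choices p [] = {({}, {})}"
  by (auto simp: choices_def ones_def bigs_def)

text \<open>The new position opens a pair whose right partner lies beyond the index, so it can be
  lowered but never deleted.\<close>

lemma choices_snoc:
  assumes p: "even (Suc (length c)) = p"
  shows "choices p (c @ [a]) = choices p c \<union>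
    (if a > 1 then (\<lambda>(A, B). (A, insert (Suc (length c)) B)) ` choices p c else {})"
    (is "?L = ?R")
proof (intro equalityI subsetI)
  fix z assume z: "z \<in> ?L"
  obtain A B where zz: "z = (A, B)" by force
  let ?n = "Suc (length c)"
  have A: "?n \<notin> A"
  proof
    assume "?n \<in> A"
    then have "Suc ?n \<in> A" using z p by (auto simp: choices_def zz)
    then have "Suc ?n \<in> ones (c @ [a])" using z by (auto simp: choices_def zz)
    then show False using ones_bounds[of "Suc ?n" "c @ [a]"] by simp
  qed
  have A': "A \<subseteq> ones c" using z A by (auto simp: choices_def zz ones_snoc split: if_splits)
  have nb: "?n \<in> B \<Longrightarrow> a > 1" using z bigs_bounds[of ?n c]
    by (force simp: choices_def zz bigs_snoc split: if_splits)
  have "(A, B - {?n}) \<in> choices p c"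
    using z A' by (auto simp: choices_def zz bigs_snoc split: if_splits)
  then show "z \<in> ?R"
    using nb by (cases "?n \<in> B") (auto simp: zz image_iff insert_absorb intro!: bexI[of _ "(A, B - {?n})"])
next
  fix z assume z: "z \<in> ?R"
  let ?n = "Suc (length c)"
  obtain A B where AB: "(A, B) \<in> choices p c"
    and zz: "z = (A, B) \<or> (a > 1 \<and> z = (A, insert ?n B))"
    using z by (cases z) (auto split: if_splits)
  have b: "Suc ?n \<notin> B" "?n \<notin> B" using choices_bounds[OF AB] by auto
  have e: "i \<in> B \<Longrightarrow> even i = p \<Longrightarrow> Suc i \<noteq> ?n" for i using p by auto
  show "z \<in> ?L"
    using zz AB b e by (auto simp: choices_def ones_snoc bigs_snoc)
qed

text \<open>The two new positions form a complete pair: at most one of them is lowered, they are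
  deleted only together, and no rule links them to earlier positions.\<close>

lemma choices_snoc2:
  assumes p: "even (Suc (length c)) = p"
  shows "choices p (c @ [a, b]) = choices p c \<union>
    (if a > 1 then (\<lambda>(A, B). (A, insert (Suc (length c)) B)) ` choices p c else {}) \<union>
    (if b > 1 then (\<lambda>(A, B). (A, insert (Suc (Suc (length c))) B)) ` choices p c else {}) \<union>
    (if a = 1 \<and> b = 1 then
       (\<lambda>(A, B). (insert (Suc (length c)) (insert (Suc (Suc (length c))) A), B)) ` choices p c else {})"
    (is "?L = ?R")
proof (intro equalityI subsetI)
  let ?n = "Suc (length c)"
  have o2: "ones (c @ [a, b]) = ones c \<union> (if a = 1 then {?n} else {}) \<union> (if b = 1 then {Suc ?n} else {})"
    using ones_snoc[of "c @ [a]" b] ones_snoc[of c a] by auto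
  have b2: "bigs (c @ [a, b]) = bigs c \<union> (if a > 1 then {?n} else {}) \<union> (if b > 1 then {Suc ?n} else {})"
    using bigs_snoc[of "c @ [a]" b] bigs_snoc[of c a] by auto
  have oc: "?n \<notin> ones c" "Suc ?n \<notin> ones c" "?n \<notin> bigs c" "Suc ?n \<notin> bigs c"
    using ones_bounds bigs_bounds by fastforce+
  {
    fix z assume z: "z \<in> ?L"
    obtain A B where zz: "z = (A, B)" by force
    have Ai: "i \<in> A \<Longrightarrow> (if even i = p then Suc i \<in> A else i - 1 \<in> A)" for i
      using z by (auto simp: choices_def zz)
    have Bi: "i \<in> B \<Longrightarrow> even i = p \<Longrightarrow> Suc i \<notin> B" for i
      using z by (auto simp: choices_def zz)
    have sub: "A \<subseteq> ones (c @ [a, b])" "B \<subseteq> bigs (c @ [a, b])"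
      using z by (auto simp: choices_def zz)
    have nA: "?n \<in> A \<longleftrightarrow> Suc ?n \<in> A" using Ai[of ?n] Ai[of "Suc ?n"] p by auto
    have nA1: "?n \<in> A \<Longrightarrow> a = 1 \<and> b = 1" using sub(1) nA oc unfolding o2 by (auto split: if_splits)
    have nB: "?n \<in> B \<Longrightarrow> a > 1 \<and> Suc ?n \<notin> B" using sub(2) Bi[of ?n] p oc unfolding b2 by (auto split: if_splits)
    have nB2: "Suc ?n \<in> B \<Longrightarrow> b > 1 \<and> ?n \<notin> B" using sub(2) Bi[of ?n] p oc unfolding b2 by (auto split: if_splits)
    let ?A = "A - {?n, Suc ?n}" and ?B = "B - {?n, Suc ?n}"
    have A: "if even i = p then Suc i \<in> ?A else i - 1 \<in> ?A" if "i \<in> ?A" for i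
    proof -
      have "i \<le> length c" using that sub(1) oc ones_bounds[of i c] unfolding o2 by (auto split: if_splits)
      then show ?thesis using Ai[of i] that p by auto
    qed
    have s1: "?A \<subseteq> ones c" using sub(1) unfolding o2 by (auto split: if_splits)
    have s2: "?B \<subseteq> bigs c" using sub(2) unfolding b2 by (auto split: if_splits)
    have B: "\<forall>i\<in>?B. even i = p \<longrightarrow> Suc i \<notin> ?B" using Bi by blast
    have AB: "(?A, ?B) \<in> choices p c"
      unfolding choices_def mem_Collect_eq prod.case using s1 s2 A B by blast
    show "z \<in> ?R"
    proof (cases "?n \<in> A")
      case True
      then have "B = ?B" "A = insert ?n (insert (Suc ?n) ?A)" using nA1 nA nB nB2 by auto
      then have "z = (\<lambda>(A, B). (insert ?n (insert (Suc ?n) A), B)) (?A, ?B)" by (simp add: zz)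
      then have "z \<in> (\<lambda>(A, B). (insert ?n (insert (Suc ?n) A), B)) ` choices p c" using AB by blast
      then show ?thesis using nA1 True by simp
    next
      case False
      then have A: "A = ?A" using nA by auto
      consider "?n \<in> B" | "Suc ?n \<in> B" | "B = ?B" by blast
      then show ?thesis
      proof cases
        case 1
        then have "z = (\<lambda>(A, B). (A, insert ?n B)) (?A, ?B)" using A nB by (auto simp: zz)
        then have "z \<in> (\<lambda>(A, B). (A, insert ?n B)) ` choices p c" using AB by blast
        then show ?thesis using nB 1 by simp
      next
        case 2
        then have "z = (\<lambda>(A, B). (A, insert (Suc ?n) B)) (?A, ?B)" using A nB2 by (auto simp: zz)
        then have "z \<in> (\<lambda>(A, B). (A, insert (Suc ?n) B)) ` choices p c" using AB by blast
        then show ?thesis using nB2 2 by simp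
      next
        case 3
        then show ?thesis using AB A zz by simp
      qed
    qed
  next
    fix z assume z: "z \<in> ?R"
    then obtain A B where AB: "(A, B) \<in> choices p c"
      and zz: "z = (A, B) \<or> (a > 1 \<and> z = (A, insert ?n B)) \<or> (b > 1 \<and> z = (A, insert (Suc ?n) B)) \<or>
        (a = 1 \<and> b = 1 \<and> z = (insert ?n (insert (Suc ?n) A), B))"
      by (cases z) (auto split: if_splits)
    have bd: "\<And>i. i \<in> A \<Longrightarrow> i \<le> length c" "\<And>i. i \<in> B \<Longrightarrow> i \<le> length c" using choices_bounds[OF AB] by auto
    then have e: "i \<in> B \<Longrightarrow> even i = p \<Longrightarrow> Suc i \<noteq> ?n \<and> Suc i \<noteq> Suc ?n" for i using p by fastforce
    have nB: "Suc ?n \<notin> B" "Suc (Suc ?n) \<notin> B" using bd(2)[of "Suc ?n"] bd(2)[of "Suc (Suc ?n)"] by auto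
    from zz show "z \<in> ?L"
    proof (elim disjE conjE)
      assume "z = (insert ?n (insert (Suc ?n) A), B)" "a = 1" "b = 1"
      then show ?thesis using AB p unfolding choices_def o2 b2 by auto
    next
      assume "z = (A, insert (Suc ?n) B)" "b > 1"
      then show ?thesis using AB p e nB unfolding choices_def o2 b2 by auto
    next
      assume "z = (A, insert ?n B)" "a > 1"
      then show ?thesis using AB p e nB unfolding choices_def o2 b2 by auto
    next
      assume "z = (A, B)"
      then show ?thesis using AB unfolding choices_def o2 b2 by auto
    qed
  }
qed

section \<open>Choice sums as compositions of one operator per pair\<close>

lemma reduce_snoc:
  "reduce (c @ [a]) A B = reduce c A B @
     (if Suc (length c) \<in> A then [] else [a - (if Suc (length c) \<in> B then 1 else 0)])"
proof -
  have *: "concat (map (\<lambda>i. if i \<notin> A then [(c @ [a]) ! (i - 1) - (if i \<in> B then 1 else 0)] else []) [1..<Suc (length c)])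
    = concat (map (\<lambda>i. if i \<notin> A then [c ! (i - 1) - (if i \<in> B then 1 else 0)] else []) [1..<Suc (length c)])"
    by (rule arg_cong[where f = concat], rule map_cong) (auto simp: nth_append)
  show ?thesis using * by (auto simp: reduce_def)
qed

lemma reduce_snoc2:
  "reduce (c @ [a, b]) A B = reduce c A B @
      (if Suc (length c) \<in> A then [] else [a - (if Suc (length c) \<in> B then 1 else 0)]) @
      (if Suc (Suc (length c)) \<in> A then [] else [b - (if Suc (Suc (length c)) \<in> B then 1 else 0)])"
  using reduce_snoc[of "c @ [a]" b A B] reduce_snoc[of c a A B] by simp

lemma reduce_cong:
  assumes "\<And>i. i \<in> {1..length c} \<Longrightarrow> i \<in> A \<longleftrightarrow> i \<in> A'"
    and "\<And>i. i \<in> {1..length c} \<Longrightarrow> i \<in> B \<longleftrightarrow> i \<in> B'"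
  shows "reduce c A B = reduce c A' B'"
  unfolding reduce_def
  by (rule arg_cong[where f = concat], rule map_cong) (use assms in auto)

lemma reduce_insert [simp]:
  assumes "i > length c"
  shows "reduce c (insert i A) B = reduce c A B" "reduce c A (insert i B) = reduce c A B"
  using assms by (auto intro!: reduce_cong)

lemma choice_sum_Nil [simp]: "choice_sum p h \<phi> [] = \<phi> []"
  by (simp add: choice_sum_def choices_Nil reduce_def)

lemma inj_on_insert_choices:
  assumes "n > length c"
  shows "inj_on (\<lambda>(A, B). (A, insert n B)) (choices p c)"
proof (rule inj_onI)
  fix z w assume zw: "z \<in> choices p c" "w \<in> choices p c"
    "(case z of (A, B) \<Rightarrow> (A, insert n B)) = (case w of (A, B) \<Rightarrow> (A, insert n B))"
  obtain A B A' B' where e: "z = (A, B)" "w = (A', B')" by (cases z, cases w)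
  have "n \<notin> B" "n \<notin> B'"
    using choices_bounds[of A B p c] choices_bounds[of A' B' p c] zw assms by (auto simp: e)
  then show "z = w" using zw(3) by (auto simp: e insert_ident)
qed

lemma sum_choices_image:
  assumes "inj_on g (choices p c)"
    and "\<And>A B. (A, B) \<in> choices p c \<Longrightarrow> (case g (A, B) of (A', B') \<Rightarrow> f A' B') =
        k * ((-1) ^ card B * h ^ (card A + card B) * \<phi> (reduce c A B))"
  shows "(\<Sum>(A, B)\<in>g ` choices p c. f A B) = k * choice_sum p h \<phi> c"
proof -
  have "(\<Sum>(A, B)\<in>g ` choices p c. f A B) = (\<Sum>z\<in>choices p c. (case g z of (A', B') \<Rightarrow> f A' B'))"
    by (simp add: sum.reindex[OF assms(1)] o_def)
  also have "\<dots> = (\<Sum>z\<in>choices p c. k * (case z of (A, B) \<Rightarrow> (-1) ^ card B * h ^ (card A + card B) * \<phi> (reduce c A B)))"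
    by (rule sum.cong) (use assms(2) in auto)
  finally show ?thesis by (simp add: choice_sum_def sum_distrib_left)
qed

lemma choice_sum_snoc:
  assumes p: "even (Suc (length c)) = p"
  shows "choice_sum p h \<phi> (c @ [a]) = choice_sum p h (\<lambda>d. \<phi> (d @ [a])) c
    - (if a > 1 then h * choice_sum p h (\<lambda>d. \<phi> (d @ [a - 1])) c else 0)"
proof -
  let ?n = "Suc (length c)"
  let ?f = "\<lambda>A B. (-1) ^ card B * h ^ (card A + card B) * \<phi> (reduce (c @ [a]) A B)"
  let ?g = "\<lambda>(A::nat set, B). (A, insert ?n B)"
  have bd: "?n \<notin> A" "?n \<notin> B" "finite A" "finite B" if "(A, B) \<in> choices p c" for A B
    using choices_bounds[OF that] finite_subset by fastforce+
  have inj: "inj_on ?g (choices p c)"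
    by (rule inj_on_insert_choices) simp
  have 0: "(\<Sum>(A, B)\<in>choices p c. ?f A B) = choice_sum p h (\<lambda>d. \<phi> (d @ [a])) c"
    unfolding choice_sum_def by (rule sum.cong) (use bd in \<open>auto simp: reduce_snoc\<close>)
  have 1: "(\<Sum>(A, B)\<in>?g ` choices p c. ?f A B) = (- h) * choice_sum p h (\<lambda>d. \<phi> (d @ [a - 1])) c"
    by (rule sum_choices_image[OF inj]) (use bd in \<open>auto simp: reduce_snoc\<close>)
  have disj: "choices p c \<inter> ?g ` choices p c = {}" by (auto dest: bd(2))
  show ?thesis
  proof (cases "a > 1")
    case True
    then show ?thesis
      using 0 1 by (subst choice_sum_def, subst choices_snoc[OF p])
        (simp add: sum.union_disjoint[OF finite_choices finite_imageI[OF finite_choices] disj])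
  next
    case False
    then show ?thesis
      using 0 by (subst choice_sum_def, subst choices_snoc[OF p]) simp
  qed
qed

text \<open>Choices in different pairs are independent, so the operator of the last pair (a, b) can
  be peeled off: do nothing, lower a, lower b, or delete both.\<close>

lemma choice_sum_snoc2:
  assumes p: "even (Suc (length c)) = p"
  shows "choice_sum p h \<phi> (c @ [a, b]) = choice_sum p h (\<lambda>d. \<phi> (d @ [a, b])) c
    - (if a > 1 then h * choice_sum p h (\<lambda>d. \<phi> (d @ [a - 1, b])) c else 0)
    - (if b > 1 then h * choice_sum p h (\<lambda>d. \<phi> (d @ [a, b - 1])) c else 0)
    + (if a = 1 \<and> b = 1 then h\<^sup>2 * choice_sum p h \<phi> c else 0)"
proof -
  let ?n = "Suc (length c)"
  let ?f = "\<lambda>A B. (-1) ^ card B * h ^ (card A + card B) * \<phi> (reduce (c @ [a, b]) A B)"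
  let ?g1 = "\<lambda>(A::nat set, B). (A, insert ?n B)"
  let ?g2 = "\<lambda>(A::nat set, B). (A, insert (Suc ?n) B)"
  let ?g3 = "\<lambda>(A, B::nat set). (insert ?n (insert (Suc ?n) A), B)"
  have bd: "?n \<notin> A" "?n \<notin> B" "Suc ?n \<notin> A" "Suc ?n \<notin> B" "finite A" "finite B"
    if "(A, B) \<in> choices p c" for A B
    using choices_bounds[OF that] finite_subset by fastforce+
  have inj: "inj_on ?g1 (choices p c)" "inj_on ?g2 (choices p c)"
    by (rule inj_on_insert_choices; simp)+
  have inj3: "inj_on ?g3 (choices p c)"
  proof (rule inj_onI)
    fix z w assume zw: "z \<in> choices p c" "w \<in> choices p c" "?g3 z = ?g3 w"
    obtain A B A' B' where e: "z = (A, B)" "w = (A', B')" by (cases z, cases w)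
    have eq: "insert ?n (insert (Suc ?n) A) = insert ?n (insert (Suc ?n) A')" "B = B'"
      using zw(3) by (simp_all add: e)
    have "insert (Suc ?n) A = insert (Suc ?n) A'"
      using eq(1) bd zw(1,2) by (subst (asm) insert_ident) (auto simp: e)
    then have "A = A'" using bd zw(1,2) by (subst (asm) insert_ident) (auto simp: e)
    then show "z = w" using eq(2) by (simp add: e)
  qed
  note red = reduce_snoc2[of c a b]
  have s0: "(\<Sum>(A, B)\<in>choices p c. ?f A B) = choice_sum p h (\<lambda>d. \<phi> (d @ [a, b])) c"
    unfolding choice_sum_def by (rule sum.cong) (use bd in \<open>auto simp: red\<close>)
  have s1: "(\<Sum>(A, B)\<in>?g1 ` choices p c. ?f A B) = (- h) * choice_sum p h (\<lambda>d. \<phi> (d @ [a - 1, b])) c"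
    by (rule sum_choices_image[OF inj(1)]) (use bd in \<open>auto simp: red\<close>)
  have s2: "(\<Sum>(A, B)\<in>?g2 ` choices p c. ?f A B) = (- h) * choice_sum p h (\<lambda>d. \<phi> (d @ [a, b - 1])) c"
    by (rule sum_choices_image[OF inj(2)]) (use bd in \<open>auto simp: red\<close>)
  have s3: "(\<Sum>(A, B)\<in>?g3 ` choices p c. ?f A B) = h\<^sup>2 * choice_sum p h \<phi> c"
    by (rule sum_choices_image[OF inj3]) (use bd in \<open>auto simp: red power2_eq_square\<close>)
  define F where "F = (\<lambda>(A, B). ?f A B)"
  define S0 where "S0 = choices p c"
  define S1 where "S1 = (if a > 1 then ?g1 ` choices p c else {})"
  define S2 where "S2 = (if b > 1 then ?g2 ` choices p c else {})"
  define S3 where "S3 = (if a = 1 \<and> b = 1 then ?g3 ` choices p c else {})"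
  have sums: "sum F S0 = choice_sum p h (\<lambda>d. \<phi> (d @ [a, b])) c"
    "sum F S1 = (if a > 1 then - h * choice_sum p h (\<lambda>d. \<phi> (d @ [a - 1, b])) c else 0)"
    "sum F S2 = (if b > 1 then - h * choice_sum p h (\<lambda>d. \<phi> (d @ [a, b - 1])) c else 0)"
    "sum F S3 = (if a = 1 \<and> b = 1 then h\<^sup>2 * choice_sum p h \<phi> c else 0)"
    unfolding F_def S0_def S1_def S2_def S3_def if_distrib[of "sum f" for f] s0 s1 s2 s3 by simp_all
  have fin: "finite S0" "finite S1" "finite S2" "finite S3"
    by (simp_all add: S0_def S1_def S2_def S3_def finite_choices)
  have d1: "S0 \<inter> S1 = {}" using bd by (fastforce simp: S0_def S1_def split: if_splits)
  have "?g1 ` choices p c \<inter> ?g2 ` choices p c = {}"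
  proof -
    have "z \<notin> ?g2 ` choices p c" if z: "z \<in> ?g1 ` choices p c" for z
    proof
      assume "z \<in> ?g2 ` choices p c"
      then obtain A B where "(A, B) \<in> choices p c" "z = (A, insert (Suc ?n) B)" by auto
      moreover obtain A' B' where "(A', B') \<in> choices p c" "z = (A', insert ?n B')" using z by auto
      ultimately show False using bd(2)[of A B] by auto
    qed
    then show ?thesis by blast
  qed
  moreover have "choices p c \<inter> ?g2 ` choices p c = {}" using bd by fastforce
  ultimately have d2: "(S0 \<union> S1) \<inter> S2 = {}" unfolding S0_def S1_def S2_def by (simp add: Int_Un_distrib2)
  have "choices p c \<inter> ?g3 ` choices p c = {}" using bd by fastforce
  then have d3: "(S0 \<union> S1 \<union> S2) \<inter> S3 = {}" by (auto simp: S0_def S1_def S2_def S3_def)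
  have "choice_sum p h \<phi> (c @ [a, b]) = sum F (S0 \<union> S1 \<union> S2 \<union> S3)"
    by (simp only: choice_sum_def choices_snoc2[OF p] F_def S0_def S1_def S2_def S3_def)
  also have "\<dots> = sum F S0 + sum F S1 + sum F S2 + sum F S3"
    using fin d1 d2 d3 by (simp add: sum.union_disjoint)
  finally show ?thesis by (simp add: sums)
qed

text \<open>The even-odd partner of position 1 would be position 0, so position 1 is never deleted.
  This starts the induction over indices of odd length.\<close>

lemma choices_single: "choices True [a] = {({}, {})} \<union> (if a > 1 then {({}, {1})} else {})"
proof -
  have o: "ones [a] = (if a = 1 then {1} else {})" "bigs [a] = (if a > 1 then {1} else {})"
    using ones_snoc[of "[]" a] bigs_snoc[of "[]" a] by (auto simp: ones_def bigs_def)
  then show ?thesis by (auto simp: choices_def o subset_singleton_iff split: if_splits)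
qed

lemma choice_sum_single:
  "choice_sum True h \<phi> [a] = \<phi> [a] - (if a > 1 then h * \<phi> [a - 1] else 0)"
proof -
  have "reduce [a] A B = (if 1 \<in> A then [] else [a - (if 1 \<in> B then 1 else 0)])" for A B
    using reduce_snoc[of "[]" a A B] by (simp add: reduce_def)
  then show ?thesis by (auto simp: choice_sum_def choices_single)
qed

section \<open>Chain sums and their increments\<close>

text \<open>
  The first list argument is the reversed index \<open>(c\<^sub>r, \<dots>, c\<^sub>1)\<close>, so its head is a block of letters
  \<open>y\<close> iff the tail has even length. An exhausted block of letters \<open>y\<close> lowers the bound by one;
  this makes the steps from \<open>x\<close> to \<open>y\<close> strict, all other steps being weak.
\<close>
function chain_sum :: "nat \<Rightarrow> nat list \<Rightarrow> nat \<Rightarrow> real" where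
  "chain_sum M [] n = 1"
| "chain_sum M (0 # cs) n = chain_sum M cs (if even (length cs) then n - 1 else n)"
| "chain_sum M (Suc b # cs) n =
     (\<Sum>m = 1..n. (if even (length cs) then 1 / (real M - real m) else 1 / real m) * chain_sum M (b # cs) m)"
  by pat_completeness auto
termination
  by (relation "Wellfounded.measure (\<lambda>(M, cs, n). sum_list cs + length cs)") auto

lemma chain_sum_zero:
  "k > 0 \<Longrightarrow> chain_sum M (k # cs) 0 = 0"
  by (cases k) auto

lemma chain_sum_y:
  assumes "even (length cs)" "k > 0"
  shows "chain_sum M (k # cs) (Suc n) = chain_sum M (k # cs) n + chain_sum M ((k - 1) # cs) (Suc n) / (real M - real (Suc n))"
  using assms by (cases k) auto

lemma chain_sum_x:
  assumes "odd (length cs)" "k > 0"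
  shows "chain_sum M (k # cs) (Suc n) = chain_sum M (k # cs) n + chain_sum M ((k - 1) # cs) (Suc n) / real (Suc n)"
  using assms by (cases k) auto

lemma parity_snoc2_induct [consumes 1, case_names Nil snoc2]:
  assumes "even (length c)" and "P []"
    and "\<And>c a b. even (length c) \<Longrightarrow> P c \<Longrightarrow> P (c @ [a, b])"
  shows "P c"
  using assms(1)
proof (induction "length c" arbitrary: c rule: less_induct)
  case less
  show ?case
  proof (cases c rule: rev_cases)
    case Nil
    then show ?thesis using assms(2) by simp
  next
    case (snoc d b)
    then have "d \<noteq> []" using less.prems by auto
    then obtain e a where e: "d = e @ [a]" by (cases d rule: rev_cases) auto
    then have "P e" using less.hyps[of e] less.prems snoc by simp
    then show ?thesis using assms(3)[of e a b] less.prems snoc e by simp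
  qed
qed

text \<open>Odd length suits the even-odd operator: position 1 stands alone and is followed by the
  complete pairs (2,3), (4,5), and so on.\<close>

lemma parity_snoc2_induct_odd [consumes 1, case_names single snoc2]:
  assumes "odd (length c)" and "\<And>a. P [a]"
    and "\<And>c a b. odd (length c) \<Longrightarrow> P c \<Longrightarrow> P (c @ [a, b])"
  shows "P c"
  using assms(1)
proof (induction "length c" arbitrary: c rule: less_induct)
  case less
  obtain d b where d: "c = d @ [b]" using less.prems by (cases c rule: rev_cases) auto
  show ?case
  proof (cases d rule: rev_cases)
    case Nil
    then show ?thesis using assms(2) d by simp
  next
    case (snoc e a)
    then have "P e" using less.hyps[of e] less.prems d by simp
    then show ?thesis using assms(3)[of e a b] less.prems snoc d by simp
  qed
qed

section \<open>Increments of chain sums under the two operators\<close>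

abbreviation EO_sum :: "real \<Rightarrow> (nat list \<Rightarrow> real) \<Rightarrow> nat list \<Rightarrow> real" where
  "EO_sum \<equiv> choice_sum True"

abbreviation OE_sum :: "real \<Rightarrow> (nat list \<Rightarrow> real) \<Rightarrow> nat list \<Rightarrow> real" where
  "OE_sum \<equiv> choice_sum False"

text \<open>Deletions come in pairs, so only indices with the same parity of length are evaluated.
  This matters because the meaning of a block in \<open>chain_sum\<close> depends on that
  parity.\<close>

lemma OE_sum_cong:
  assumes "even (length c)" and "\<And>d. even (length d) \<Longrightarrow> \<phi> d = \<psi> d"
  shows "OE_sum h \<phi> c = OE_sum h \<psi> c"
  using assms
proof (induction c arbitrary: \<phi> \<psi> rule: parity_snoc2_induct)
  case (snoc2 c a b)
  have "OE_sum h (\<lambda>d. \<phi> (d @ [x, y])) c = OE_sum h (\<lambda>d. \<psi> (d @ [x, y])) c" for x y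
    by (rule snoc2.IH) (use snoc2.prems in simp)
  moreover have "OE_sum h \<phi> c = OE_sum h \<psi> c" by (rule snoc2.IH) (use snoc2.prems in simp)
  ultimately show ?case using snoc2.hyps by (simp add: choice_sum_snoc2)
qed simp

lemma EO_sum_cong:
  assumes "odd (length c)" and "\<And>d. odd (length d) \<Longrightarrow> \<phi> d = \<psi> d"
  shows "EO_sum h \<phi> c = EO_sum h \<psi> c"
  using assms
proof (induction c arbitrary: \<phi> \<psi> rule: parity_snoc2_induct_odd)
  case (single a)
  then show ?case by (simp add: choice_sum_single)
next
  case (snoc2 c a b)
  have "EO_sum h (\<lambda>d. \<phi> (d @ [x, y])) c = EO_sum h (\<lambda>d. \<psi> (d @ [x, y])) c" for x y
    by (rule snoc2.IH) (use snoc2.prems in simp)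
  moreover have "EO_sum h \<phi> c = EO_sum h \<psi> c" by (rule snoc2.IH) (use snoc2.prems in simp)
  ultimately show ?case using snoc2.hyps by (simp add: choice_sum_snoc2)
qed

lemma choice_sum_zero: "choice_sum p h (\<lambda>d. 0) c = 0"
  by (simp add: choice_sum_def case_prod_beta)

lemma choice_sum_lin: "choice_sum p h (\<lambda>d. \<phi> d + \<psi> d / k) c = choice_sum p h \<phi> c + choice_sum p h \<psi> c / k"
  by (simp add: choice_sum_def case_prod_beta sum.distrib[symmetric] sum_divide_distrib algebra_simps)

lemma OE_sum_zero:
  assumes "even (length W)" "k > 0"
  shows "OE_sum h (\<lambda>d. chain_sum M (rev (d @ [k])) 0) W = 0" "OE_sum h (\<lambda>d. chain_sum M (rev (d @ [c, k])) 0) W = 0"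
  using assms by (simp_all add: chain_sum_zero choice_sum_zero)

lemma OE_sum_y:
  assumes "even (length W)" "k > 0"
  shows "OE_sum h (\<lambda>d. chain_sum M (rev (d @ [k])) (Suc n)) W =
    OE_sum h (\<lambda>d. chain_sum M (rev (d @ [k])) n) W
    + OE_sum h (\<lambda>d. chain_sum M (rev (d @ [k - 1])) (Suc n)) W / (real M - real (Suc n))"
  unfolding choice_sum_lin[symmetric]
  by (rule OE_sum_cong[OF assms(1)]) (use assms chain_sum_y in simp)

lemma OE_sum_x:
  assumes "even (length W)" "k > 0"
  shows "OE_sum h (\<lambda>d. chain_sum M (rev (d @ [c, k])) (Suc n)) W =
    OE_sum h (\<lambda>d. chain_sum M (rev (d @ [c, k])) n) W
    + OE_sum h (\<lambda>d. chain_sum M (rev (d @ [c, k - 1])) (Suc n)) W / real (Suc n)"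
  unfolding choice_sum_lin[symmetric]
  by (rule OE_sum_cong[OF assms(1)]) (use assms chain_sum_x in simp)

lemma EO_sum_x:
  assumes "odd (length V)" "k > 0"
  shows "EO_sum h (\<lambda>d. chain_sum M (rev (d @ [k])) (Suc n)) V =
    EO_sum h (\<lambda>d. chain_sum M (rev (d @ [k])) n) V
    + EO_sum h (\<lambda>d. chain_sum M (rev (d @ [k - 1])) (Suc n)) V / real (Suc n)"
  unfolding choice_sum_lin[symmetric]
  by (rule EO_sum_cong[OF assms(1)]) (use assms chain_sum_x in simp)

lemma EO_sum_y:
  assumes "odd (length V)" "k > 0"
  shows "EO_sum h (\<lambda>d. chain_sum M (rev (d @ [c, k])) (Suc n)) V =
    EO_sum h (\<lambda>d. chain_sum M (rev (d @ [c, k])) n) V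
    + EO_sum h (\<lambda>d. chain_sum M (rev (d @ [c, k - 1])) (Suc n)) V / (real M - real (Suc n))"
  unfolding choice_sum_lin[symmetric]
  by (rule EO_sum_cong[OF assms(1)]) (use assms chain_sum_y in simp)

lemma OE_sum_y0: "even (length W) \<Longrightarrow> OE_sum h (\<lambda>d. chain_sum M (rev (d @ [0])) n) W = OE_sum h (\<lambda>d. chain_sum M (rev d) (n - 1)) W"
  by (rule OE_sum_cong) auto

lemma EO_sum_x0: "odd (length V) \<Longrightarrow> EO_sum h (\<lambda>d. chain_sum M (rev (d @ [0])) n) V = EO_sum h (\<lambda>d. chain_sum M (rev d) n) V"
  by (rule EO_sum_cong) auto

lemma EO_sum_y0: "odd (length V) \<Longrightarrow>
  EO_sum h (\<lambda>d. chain_sum M (rev (d @ [c, 0])) n) V = EO_sum h (\<lambda>d. chain_sum M (rev (d @ [c])) (n - 1)) V"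
  by (rule EO_sum_cong) auto

lemma OE_sum_x0: "even (length W) \<Longrightarrow>
  OE_sum h (\<lambda>d. chain_sum M (rev (d @ [c, 0])) n) W = OE_sum h (\<lambda>d. chain_sum M (rev (d @ [c])) n) W"
  by (rule OE_sum_cong) auto

lemma EO_sum_zero:
  assumes "odd (length V)" "k > 0"
  shows "EO_sum h (\<lambda>d. chain_sum M (rev (d @ [k])) 0) V = 0" "EO_sum h (\<lambda>d. chain_sum M (rev (d @ [c, k])) 0) V = 0"
  using assms by (simp_all add: chain_sum_zero choice_sum_zero)

text \<open>
  The right-hand sides of the two companions of the main identity for words ending in \<open>x\<close> and in \<open>y\<close>.
  Here the last block is only partially reduced, and unlike the odd-even operator \<open>x_side\<close> also lets
  a last block \<open>x\<^sup>1\<close> be emptied. This is what closes the induction on the number of blocks.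
\<close>
definition x_side :: "nat \<Rightarrow> nat list \<Rightarrow> nat \<Rightarrow> nat \<Rightarrow> nat \<Rightarrow> real" where
  "x_side N W c k n = OE_sum (1 / N) (\<lambda>d. chain_sum N (rev (d @ [c, k])) n) W
     - (if c > 1 then 1 / N * OE_sum (1 / N) (\<lambda>d. chain_sum N (rev (d @ [c - 1, k])) n) W else 0)
     - 1 / N * OE_sum (1 / N) (\<lambda>d. chain_sum N (rev (d @ [c, k - 1])) n) W"

definition y_side :: "nat \<Rightarrow> nat list \<Rightarrow> nat \<Rightarrow> nat \<Rightarrow> real" where
  "y_side N W c n = OE_sum (1 / N) (\<lambda>d. chain_sum N (rev (d @ [c])) n) W
     + (if c = 1 then 1 / N * OE_sum (1 / N) (\<lambda>d. chain_sum N (rev d) n) W else 0)"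

lemma x_side_0: "even (length W) \<Longrightarrow> c > 0 \<Longrightarrow> k > 0 \<Longrightarrow> x_side N W c k 0 = 0"
  by (cases "k = 1") (simp_all add: x_side_def OE_sum_zero[simplified] OE_sum_x0[simplified] chain_sum_zero choice_sum_zero)

lemma x_side_Suc:
  assumes "even (length W)" "k > 1"
  shows "x_side N W c k (Suc n) = x_side N W c k n + x_side N W c (k - 1) (Suc n) / real (Suc n)"
proof -
  have "k > 0" "k - 1 > 0" using assms(2) by auto
  note X = OE_sum_x[OF assms(1) \<open>k > 0\<close>] OE_sum_x[OF assms(1) \<open>k - 1 > 0\<close>]
  show ?thesis unfolding x_side_def X
    by (simp add: algebra_simps add_divide_distrib diff_divide_distrib del: of_nat_Suc)
qed

lemma x_side_1_Suc:
  assumes W: "even (length W)" and "c > 0" "Suc n < N"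
  shows "x_side N W c 1 (Suc n) = x_side N W c 1 n + y_side N W c n / real (Suc n)"
proof -
  let ?h = "1 / real N"
  have nz: "real N \<noteq> 0" "real (Suc n) \<noteq> 0" "real N - real (Suc n) \<noteq> 0"
    using assms by (auto simp del: of_nat_Suc)
  \<comment> \<open>Partial fractions at m = Suc n: \<open>P\<close> is the sum for the
    \<open>y\<close>-block up to n, and z / (N' - m) is its increment, \<open>z\<close> having one
    \<open>y\<close> fewer. In \<open>eq1\<close>, where c = 1, the term with c - 1 is absent and z
    / N' survives; this is the correction in \<open>y_side\<close>.\<close>
  have eq: "((P + z / (N' - m)) - (1 / N') * z) / m - (1 / N') * (z / (N' - m)) = P / m"
    if "N' \<noteq> 0" "m \<noteq> 0" "N' - m \<noteq> 0" for P z N' m :: real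
    using that by (simp add: divide_simps) (simp add: algebra_simps)
  have eq1: "(P + z / (N' - m)) / m - (1 / N') * (z / (N' - m)) = (P + 1 / N' * z) / m"
    if "N' \<noteq> 0" "m \<noteq> 0" "N' - m \<noteq> 0" for P z N' m :: real
    using that by (simp add: divide_simps) (simp add: algebra_simps)
  have x1: "OE_sum ?h (\<lambda>d. chain_sum N (rev (d @ [c', 1])) (Suc n)) W = OE_sum ?h (\<lambda>d. chain_sum N (rev (d @ [c', 1])) n) W
     + OE_sum ?h (\<lambda>d. chain_sum N (rev (d @ [c'])) (Suc n)) W / real (Suc n)" for c'
    using OE_sum_x[OF W, of 1 ?h N c' n] OE_sum_x0[OF W, of ?h N c' "Suc n"] by simp
  have x0: "OE_sum ?h (\<lambda>d. chain_sum N (rev (d @ [c', 1 - 1])) m) W = OE_sum ?h (\<lambda>d. chain_sum N (rev (d @ [c'])) m) W" for c' m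
    using OE_sum_x0[OF W, of ?h N c' m] by simp
  note y = OE_sum_y[OF W \<open>c > 0\<close>, of ?h N n]
  show ?thesis
  proof (cases "c = 1")
    case True
    have y0: "OE_sum ?h (\<lambda>d. chain_sum N (rev (d @ [c - 1])) (Suc n)) W = OE_sum ?h (\<lambda>d. chain_sum N (rev d) n) W"
      using OE_sum_y0[OF W, of ?h N "Suc n"] True by simp
    show ?thesis using eq1[OF nz, of "OE_sum ?h (\<lambda>d. chain_sum N (rev (d @ [c])) n) W" "OE_sum ?h (\<lambda>d. chain_sum N (rev d) n) W"]
      unfolding x_side_def y_side_def x1 x0 y y0 using True by (simp add: algebra_simps)
  next
    case False
    then have "c > 1" using \<open>c > 0\<close> by simp
    show ?thesis using eq[OF nz, of "OE_sum ?h (\<lambda>d. chain_sum N (rev (d @ [c])) n) W" "OE_sum ?h (\<lambda>d. chain_sum N (rev (d @ [c - 1])) (Suc n)) W"]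
      unfolding x_side_def y_side_def x1 x0 y using \<open>c > 1\<close> by (simp add: diff_divide_distrib algebra_simps)
  qed
qed

lemma OE_sum_eq_x_side:
  assumes "even (length W)" "k > 1"
  shows "OE_sum (1 / N) (\<lambda>d. chain_sum N (rev d) n) (W @ [c, k]) = x_side N W c k n"
  using assms by (simp add: choice_sum_snoc2 x_side_def)

text \<open>\<open>x_side\<close> subtracts the word whose last \<open>x\<close> has been emptied,
  which is no choice for an entry 1. Adding \<open>y_side\<close> over N restores it and supplies
  the quadratic term of the deleted pair when c = 1.\<close>

lemma OE_sum_eq_x_side_1:
  assumes "even (length W)"
  shows "OE_sum (1 / N) (\<lambda>d. chain_sum N (rev d) n) (W @ [c, 1]) = x_side N W c 1 n + 1 / N * y_side N W c n"
  using assms OE_sum_x0[OF assms, of "1/N" N _ n]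
  by (auto simp: choice_sum_snoc2 x_side_def y_side_def algebra_simps power2_eq_square)

text \<open>Both sides vanish at n = 0 and have the same increments in n: the claim for k - 1
  divided by n + 1 or, when the \<open>x\<close>-block runs out, the companion for words ending in
  \<open>y\<close>, which enters as \<open>Y\<close>. The bounds Suc n and n in \<open>Y\<close>
  reflect the shift of the letters \<open>y\<close>.\<close>

lemma EO_sum_eq_x_side:
  assumes W: "even (length W)" and c: "c > 0"
    and Y: "\<And>n. Suc n \<le> N \<Longrightarrow> EO_sum (1 / N) (\<lambda>d. chain_sum (Suc N) (rev d) (Suc n)) (W @ [c]) = y_side N W c n"
    and "k > 0" "n < N"
  shows "EO_sum (1 / N) (\<lambda>d. chain_sum (Suc N) (rev (d @ [k])) n) (W @ [c]) = x_side N W c k n"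
  using \<open>k > 0\<close> \<open>n < N\<close>
proof (induction k arbitrary: n)
  case (Suc k)
  have V: "odd (length (W @ [c]))" using W by simp
  from Suc.prems(2) show ?case
  proof (induction n)
    case 0
    then show ?case using EO_sum_zero(1)[OF V, of "Suc k"] x_side_0[OF W c, of "Suc k"] by simp
  next
    case (Suc n)
    then have IH: "EO_sum (1 / N) (\<lambda>d. chain_sum (Suc N) (rev (d @ [Suc k])) n) (W @ [c]) = x_side N W c (Suc k) n" by simp
    have e: "EO_sum (1 / N) (\<lambda>d. chain_sum (Suc N) (rev (d @ [Suc k])) (Suc n)) (W @ [c]) = x_side N W c (Suc k) n
       + EO_sum (1 / N) (\<lambda>d. chain_sum (Suc N) (rev (d @ [k])) (Suc n)) (W @ [c]) / real (Suc n)"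
      using EO_sum_x[OF V, of "Suc k" "1/N" "Suc N" n] IH by simp
    show ?case
    proof (cases "k = 0")
      case True
      have "EO_sum (1 / N) (\<lambda>d. chain_sum (Suc N) (rev (d @ [0])) (Suc n)) (W @ [c]) = y_side N W c n"
        using Y[of n] EO_sum_x0[OF V, of "1/N" "Suc N" "Suc n"] Suc.prems by simp
      then show ?thesis using e x_side_1_Suc[OF W c Suc.prems] True by simp
    next
      case False
      then show ?thesis using e x_side_Suc[OF W, of "Suc k" N c n] \<open>\<And>n. 0 < k \<Longrightarrow> n < N \<Longrightarrow> _ n\<close>[of "Suc n"] Suc.prems by simp
    qed
  qed
qed simp

section \<open>The recursion of chain sums\<close>

text \<open>Chains in {1..n+1} with smallest entry 1 carry a factor 1/N and are the subtracted term;
  the others lie in {2..n+1} and shift down by one. For e = 1 nothing is subtracted, and the chain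
  consisting of 1 alone leaves the 1/N in \<open>y_side\<close>.\<close>

lemma EO_sum_eq_y_side_single:
  assumes "e > 0" "n < N"
  shows "EO_sum (1 / N) (\<lambda>d. chain_sum (Suc N) (rev d) (Suc n)) [e] = y_side N [] e n"
proof -
  let ?a = "\<lambda>e n. chain_sum (Suc N) [e] n" and ?b = "\<lambda>e n. chain_sum N [e] n"
  have a: "?a e (Suc n) = ?a e n + ?a (e - 1) (Suc n) / (real N - real n)" if "e > 0" for e n
    using chain_sum_y[of "[]" e "Suc N" n] that by simp
  have b: "?b e (Suc n) = ?b e n + ?b (e - 1) (Suc n) / (real N - real (Suc n))" if "e > 0" for e n
    using chain_sum_y[of "[]" e N n] that by simp
  have a1: "?a 1 (Suc n) = ?b 1 n + 1 / N" if "n < N" for n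
    using that
  proof (induction n)
    case 0
    then show ?case using a[of 1 0] by (simp add: chain_sum_zero)
  next
    case (Suc n)
    then show ?case using a[of 1 "Suc n"] b[of 1 n] by simp
  qed
  have "?a (Suc e) (Suc n) - 1 / N * ?a e (Suc n) = ?b (Suc e) n" if "e > 0" "n < N" for e n
    using that
  proof (induction e arbitrary: n)
    case (Suc e)
    have br: "?a (Suc e) (Suc n) - 1 / N * ?a e (Suc n) = ?b (Suc e) n" if "n < N" for n
    proof (cases "e = 0")
      case True
      then show ?thesis using a1[OF that] by simp
    next
      case False
      then show ?thesis using Suc.IH[OF _ that] by simp
    qed
    from \<open>n < N\<close> show ?case
    proof (induction n)
      case 0
      have "?a (Suc (Suc e)) 1 - 1 / N * ?a (Suc e) 1 = (?a (Suc e) 1 - 1 / N * ?a e 1) / N"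
        using a[of "Suc (Suc e)" 0] a[of "Suc e" 0] by (simp add: chain_sum_zero diff_divide_distrib del: chain_sum.simps(3))
      then show ?case using br[of 0] 0 by (simp add: chain_sum_zero del: chain_sum.simps(3))
    next
      case (Suc n)
      have "?a (Suc (Suc e)) (Suc (Suc n)) - 1 / N * ?a (Suc e) (Suc (Suc n))
         = (?a (Suc (Suc e)) (Suc n) - 1 / N * ?a (Suc e) (Suc n))
           + (?a (Suc e) (Suc (Suc n)) - 1 / N * ?a e (Suc (Suc n))) / (real N - real (Suc n))"
        using a[of "Suc (Suc e)" "Suc n"] a[of "Suc e" "Suc n"]
        by (simp add: diff_divide_distrib algebra_simps del: chain_sum.simps(3))
      then show ?case using br[of "Suc n"] Suc b[of "Suc (Suc e)" n] by (simp del: chain_sum.simps(3))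
    qed
  qed simp
  from this[of "e - 1" n] a1[of n] assms show ?thesis
    by (cases "e = 1") (simp_all add: choice_sum_single y_side_def del: chain_sum.simps(3))
qed

text \<open>The left side gains the even-odd pair (k, e), while the right side completes the
  odd-even pair (c, k). As these overlap in k, the right side is unfolded through
  \<open>x_side\<close> before increments in n are compared.\<close>

lemma EO_sum_eq_y_side_snoc2:
  assumes W: "even (length W)" and c: "c > 0" and k: "k > 0"
    and Y: "\<And>n. n < N \<Longrightarrow> EO_sum (1 / N) (\<lambda>d. chain_sum (Suc N) (rev d) (Suc n)) (W @ [c]) = y_side N W c n"
    and "e > 0" "n < N"
  shows "EO_sum (1 / N) (\<lambda>d. chain_sum (Suc N) (rev d) (Suc n)) ((W @ [c]) @ [k, e]) = y_side N (W @ [c, k]) e n"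
proof -
  let ?h = "1 / real N"
  define h where "h = ?h"
  have V: "odd (length (W @ [c]))" and W': "even (length (W @ [c, k]))" using W by auto
  define E where "E = (\<lambda>x y n. EO_sum ?h (\<lambda>d. chain_sum (Suc N) (rev (d @ [x, y])) n) (W @ [c]))"
  define U where "U = (\<lambda>n. y_side N W c n)"
  define X where "X = (\<lambda>k n. x_side N W c k n)"
  define P where "P = (\<lambda>e n. OE_sum ?h (\<lambda>d. chain_sum N (rev (d @ [e])) n) (W @ [c, k]))"
  define P0 where "P0 = (\<lambda>n. OE_sum ?h (\<lambda>d. chain_sum N (rev d) n) (W @ [c, k]))"
  \<comment> \<open>\<open>D\<close> collects the choices that leave e alone; those that touch e are
    added in \<open>G\<close>.\<close>
  define D where "D = (\<lambda>e n. E k e n - (if k > 1 then h * E (k - 1) e n else 0))"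
  have G: "EO_sum ?h (\<lambda>d. chain_sum (Suc N) (rev d) (Suc n)) ((W @ [c]) @ [k, e]) =
      D e (Suc n) - (if e > 1 then h * E k (e - 1) (Suc n) else 0)
      + (if k = 1 \<and> e = 1 then h\<^sup>2 * U n else 0)" if "n < N" for e n
    using V Y[OF that] by (subst choice_sum_snoc2) (simp_all add: D_def E_def U_def h_def)
  have R: "y_side N (W @ [c, k]) e n = P e n + (if e = 1 then h * P0 n else 0)" for e n
    by (simp add: y_side_def P_def P0_def h_def)
  have XE: "EO_sum ?h (\<lambda>d. chain_sum (Suc N) (rev (d @ [k])) n) (W @ [c]) = X k n" if "k > 0" "n < N" for k n
    unfolding X_def by (rule EO_sum_eq_x_side[OF W c Y that]) simp
  have E_Suc: "E x y (Suc n) = E x y n + E x (y - 1) (Suc n) / (real N - real n)" if "y > 0" for x y n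
    using EO_sum_y[OF V that, of ?h "Suc N" x n] by (simp add: E_def)
  have E0: "E x y 0 = 0" if "y > 0" for x y
    using EO_sum_zero(2)[OF V that] by (simp add: E_def)
  have E_0: "E x 0 (Suc n) = X x n" if "x > 0" "n < N" for x n
    using EO_sum_y0[OF V, of ?h "Suc N" x "Suc n"] XE[OF that] by (simp add: E_def)
  have P_Suc: "P y (Suc n) = P y n + P (y - 1) (Suc n) / (real N - real (Suc n))" if "y > 0" for y n
    using OE_sum_y[OF W' that, of ?h N n] by (simp add: P_def)
  have P_0: "P 0 (Suc n) = P0 n" for n
    using OE_sum_y0[OF W', of ?h N "Suc n"] by (simp add: P_def P0_def)
  have P0: "P y 0 = 0" if "y > 0" for y
    using OE_sum_zero(1)[OF W' that] by (simp add: P_def)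
  have PX: "P0 n = (if k = 1 then X 1 n + h * U n else X k n)" for n
    using OE_sum_eq_x_side[OF W, of k N n c] OE_sum_eq_x_side_1[OF W, of N n c] k
    by (auto simp: P0_def X_def U_def h_def)
  have X_Suc: "X k (Suc n) = X k n + X (k - 1) (Suc n) / real (Suc n)" if "k > 1" for k n
    using x_side_Suc[OF W that] by (simp add: X_def)
  have X1_Suc: "X 1 (Suc n) = X 1 n + U n / real (Suc n)" if "Suc n < N" for n
    using x_side_1_Suc[OF W c that] by (simp add: X_def U_def)
  have X0: "X k 0 = 0" if "k > 0" for k
    using x_side_0[OF W c that] by (simp add: X_def)

  \<comment> \<open>The block e = 1 cannot be lowered, only deleted together with k = 1, which gives
    the quadratic term on the left; h * P0 n on the right is the correction in
    \<open>y_side\<close>.\<close>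
  have D1: "D 1 (Suc n) + (if k = 1 then h\<^sup>2 * U n else 0) = P 1 n + h * P0 n" if "n < N" for n
    using that
  proof (induction n)
    case 0
    have "D 1 (Suc 0) = 0"
      using E_Suc[of 1 _ 0] E_0[of _ 0] E0[of 1] 0 k X0[of k] X0[of "k - 1"] by (auto simp: D_def)
    then show ?case using PX[of 0] P0[of 1] X0[of k] k by (auto simp: power2_eq_square)
  next
    case (Suc n)
    have nz: "real N \<noteq> 0" "real (Suc n) \<noteq> 0" "real N - real (Suc n) \<noteq> 0"
      using Suc.prems by (auto simp del: of_nat_Suc)
    have pf: "r / m / (N' - m) = 1 / N' * r / (N' - m) + 1 / N' * r / m"
      if "N' \<noteq> 0" "m \<noteq> 0" "N' - m \<noteq> 0" for r N' m :: real
      using that by (simp add: divide_simps) (simp add: algebra_simps)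
    have IH: "D 1 (Suc n) + (if k = 1 then h\<^sup>2 * U n else 0) = P 1 n + h * P0 n"
      using Suc by simp
    have P1: "P 1 (Suc n) = P 1 n + P0 n / (real N - real (Suc n))"
      using P_Suc[of 1 n] P_0[of n] by simp
    have E1: "E x 1 (Suc (Suc n)) = E x 1 (Suc n) + X x (Suc n) / (real N - real (Suc n))" if "x > 0" for x
      using E_Suc[of 1 x "Suc n"] E_0[OF that, of "Suc n"] Suc.prems by simp
    show ?case
    proof (cases "k = 1")
      case True
      have "D 1 (Suc (Suc n)) = D 1 (Suc n) + X 1 (Suc n) / (real N - real (Suc n))"
        using E1[of 1] True by (simp add: D_def)
      also have "X 1 (Suc n) / (real N - real (Suc n)) = X 1 n / (real N - real (Suc n))
          + (h * U n / (real N - real (Suc n)) + h * U n / real (Suc n))"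
        using pf[OF nz, of "U n"] X1_Suc[OF Suc.prems] by (simp add: add_divide_distrib h_def del: of_nat_Suc)
      finally show ?thesis using IH True P1 PX[of n] PX[of "Suc n"] X1_Suc[OF Suc.prems]
        by (simp add: add_divide_distrib algebra_simps power2_eq_square del: of_nat_Suc)
    next
      case False
      then have k1: "k > 1" "k - 1 > 0" using k by auto
      have "D 1 (Suc (Suc n)) = D 1 (Suc n)
          + (X k (Suc n) - h * X (k - 1) (Suc n)) / (real N - real (Suc n))"
        using E1[OF k] E1[OF k1(2)] k1 by (simp add: D_def diff_divide_distrib algebra_simps del: of_nat_Suc)
      also have "(X k (Suc n) - h * X (k - 1) (Suc n)) / (real N - real (Suc n)) =
          X k n / (real N - real (Suc n)) + h * X (k - 1) (Suc n) / real (Suc n)"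
        using pf[OF nz, of "X (k - 1) (Suc n)"] X_Suc[OF k1(1), of n]
        by (simp add: add_divide_distrib diff_divide_distrib h_def del: of_nat_Suc)
      finally show ?thesis using IH False P1 PX[of n] PX[of "Suc n"] X_Suc[OF k1(1), of n]
        by (simp add: add_divide_distrib algebra_simps del: of_nat_Suc)
    qed
  qed
  have D2: "D (Suc e) (Suc n) - h * E k e (Suc n) = P (Suc e) n" if "e > 0" "n < N" for e n
    using that
  proof (induction e arbitrary: n)
    case (Suc e)
    \<comment> \<open>Uniform in e: for e = 0 the term with \<open>E k 0\<close> is not a choice of
      the recursion, but by \<open>E_0\<close> and \<open>PX\<close> subtracting it cancels exactly
      the corrections in \<open>D1\<close>.\<close>
    have br: "D (Suc e) (Suc n) - h * E k e (Suc n) = P (Suc e) n" if "n < N" for n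
    proof (cases "e = 0")
      case True
      then show ?thesis using D1[OF that] E_0[OF k that] PX[of n]
        by (auto simp: algebra_simps power2_eq_square split: if_splits)
    next
      case False
      then show ?thesis using Suc.IH[OF _ that] by simp
    qed
    have D_Suc: "D (Suc (Suc e)) (Suc n) - h * E k (Suc e) (Suc n) =
       D (Suc (Suc e)) n - h * E k (Suc e) n + P (Suc e) n / (real N - real n)" if "n < N" for n
      using E_Suc[of "Suc (Suc e)" _ n] E_Suc[of "Suc e" _ n] unfolding br[OF that, symmetric]
      by (simp add: D_def diff_divide_distrib add_divide_distrib algebra_simps)
    from \<open>n < N\<close> show ?case
    proof (induction n)
      case 0
      then show ?case using D_Suc[of 0] by (simp add: P0 D_def E0)
    next
      case (Suc n)
      then show ?case using D_Suc[of "Suc n"] P_Suc[of "Suc (Suc e)" n] by simp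
    qed
  qed simp
  show ?thesis
  proof (cases "e = 1")
    case True
    then show ?thesis using D1[of n] G[of n 1] R[of 1 n] assms by simp
  next
    case False
    then show ?thesis using D2[of "e - 1" n] G[of n e] R[of e n] assms by simp
  qed
qed

lemma EO_sum_eq_y_side:
  assumes "even (length W)" "\<forall>k\<in>set (W @ [c]). k > 0" "n < N"
  shows "EO_sum (1 / N) (\<lambda>d. chain_sum (Suc N) (rev d) (Suc n)) (W @ [c]) = y_side N W c n"
  using assms
proof (induction W arbitrary: c n rule: parity_snoc2_induct)
  case Nil
  then show ?case using EO_sum_eq_y_side_single[of c n N] by simp
next
  case (snoc2 W a b)
  then show ?case using EO_sum_eq_y_side_snoc2[of W a b N c n] by simp
qed

text \<open>An \<open>x\<close> at the top position N has weight 1/N = h. For k > 1, lowering the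
  last block therefore removes exactly the chains that reach N, and the bound drops to N - 1. For k
  = 1 these chains stay and form the extra \<open>y_side\<close> term of
  \<open>OE_sum_eq_x_side_1\<close>.\<close>

lemma EO_sum_eq_OE_sum:
  assumes "even (length c)" "\<forall>k\<in>set c. k > 0" "N > 0" "c \<noteq> []"
  shows "EO_sum (1 / N) (\<lambda>d. chain_sum (Suc N) (rev d) N) c = OE_sum (1 / N) (\<lambda>d. chain_sum N (rev d) (N - 1)) c"
proof -
  obtain N' where N: "N = Suc N'" using assms by (cases N) auto
  obtain d k where d: "c = d @ [k]" using assms by (cases c rule: rev_cases) auto
  then obtain W a where c: "c = W @ [a, k]" using assms by (cases d rule: rev_cases) auto
  have W: "even (length W)" and V: "odd (length (W @ [a]))" and k: "k > 0" and a: "a > 0"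
    using assms c by auto
  have Y: "EO_sum (1 / N) (\<lambda>d. chain_sum (Suc N) (rev d) (Suc n)) (W @ [a]) = y_side N W a n" if "n < N" for n
    using EO_sum_eq_y_side[OF W _ that] assms c by auto
  have X: "EO_sum (1 / N) (\<lambda>d. chain_sum (Suc N) (rev (d @ [k])) N') (W @ [a]) = x_side N W a k N'"
    by (rule EO_sum_eq_x_side[OF W a Y k]) (simp_all add: N)
  \<comment> \<open>The last position is even and has no right partner, so its only choice is to be
    lowered or not.\<close>
  have "EO_sum (1 / N) (\<lambda>d. chain_sum (Suc N) (rev d) N) c =
      EO_sum (1 / N) (\<lambda>d. chain_sum (Suc N) (rev (d @ [k])) N) (W @ [a])
      - (if k > 1 then 1 / N * EO_sum (1 / N) (\<lambda>d. chain_sum (Suc N) (rev (d @ [k - 1])) N) (W @ [a]) else 0)"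
    using choice_sum_snoc[of "W @ [a]" True "1 / N" _ k] V by (simp add: c)
  also have "\<dots> = (if k > 1 then x_side N W a k N' else x_side N W a 1 N' + 1 / N * y_side N W a N')"
    using EO_sum_x[OF V k, of "1 / N" "Suc N" N'] X EO_sum_x0[OF V, of "1 / N" "Suc N" N] Y[of N'] k
    by (cases "k = 1") (simp_all add: N)
  also have "\<dots> = OE_sum (1 / N) (\<lambda>d. chain_sum N (rev d) N') c"
    using OE_sum_eq_x_side[OF W, of k N N' a] OE_sum_eq_x_side_1[OF W, of N N' a] k by (cases "k = 1") (simp_all add: c)
  finally show ?thesis by (simp add: N)
qed

section \<open>Words, truncated values and the support of D\<close>

text \<open>The index is given in reverse, its head belonging to the largest summation variable.\<close>
fun trunc_mzv :: "nat list \<Rightarrow> nat \<Rightarrow> real" where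
  "trunc_mzv [] N = 1"
| "trunc_mzv (k # ks) N = (\<Sum>n = 1..N. trunc_mzv ks (n - 1) / real n ^ k)"

lemma trunc_mzv_Suc: "trunc_mzv (k # ks) (Suc N) = trunc_mzv (k # ks) N + trunc_mzv ks N / real (Suc N) ^ k"
  by simp

definition trunc_Zword :: "nat \<Rightarrow> letter list \<Rightarrow> real" where
  "trunc_Zword N w = trunc_mzv (rev (decode w)) N"

lemma decode_append_Y: "decode (w @ Y # v) = decode w @ decode (Y # v)"
proof (induction w rule: decode.induct)
  case (3 w)
  show ?case
  proof (cases "\<forall>l\<in>set w. l = X")
    case True
    then have "takeWhile (\<lambda>l. l = X) w = w" "dropWhile (\<lambda>l. l = X) w = []"
      by (auto simp: takeWhile_eq_all_conv dropWhile_eq_Nil_conv)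
    note d = this
    show ?thesis using True by (simp add: takeWhile_append dropWhile_append d)
  next
    case False
    then show ?thesis using 3 by (auto simp: takeWhile_append dropWhile_append)
  qed
qed auto

lemma decode_Y_replicate: "decode (Y # replicate j X) = [Suc j]"
  by (simp add: takeWhile_replicate dropWhile_replicate)

lemma decode_append_yxpow: "decode (w @ yxpow j) = decode w @ [Suc j]"
  using decode_append_Y[of w "replicate j X"] decode_Y_replicate[of j] by (simp add: yxpow_def)

lemma decode_append_xpow:
  assumes "Y \<in> set w"
  shows "\<exists>ks k. decode w = ks @ [k] \<and> (\<forall>j. decode (w @ xpow j) = ks @ [k + j])"
proof -
  obtain u v where w: "w = u @ Y # v" "Y \<notin> set v" using split_list_last[OF assms] by blast
  have "v = replicate (length v) X"
    by (rule replicate_eqI) (use w(2) letter.exhaust in metis)+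
  then obtain i where v: "v = replicate i X" by blast
  have "decode w = decode u @ [Suc i]"
    using decode_append_yxpow[of u i] by (simp add: yxpow_def w v)
  moreover have "decode (w @ xpow j) = decode u @ [Suc i + j]" for j
    using decode_append_yxpow[of u "i + j"] by (simp add: yxpow_def xpow_def w v replicate_add)
  ultimately show ?thesis by blast
qed

text \<open>The words that span H^{>=2}, the target of D; the bound on the entries is what makes
  their truncated values converge.\<close>

definition ge2_word :: "letter list \<Rightarrow> bool" where
  "ge2_word w \<longleftrightarrow> w = [] \<or> (hd w = Y \<and> last w = X \<and> (\<forall>k\<in>set (decode w). 2 \<le> k))"

lemma ge2_word_append_xpow:
  assumes "ge2_word w" "w \<noteq> []"
  shows "ge2_word (w @ xpow j)"
proof -
  have w: "hd w = Y" "last w = X" "\<forall>k\<in>set (decode w). 2 \<le> k" using assms by (auto simp: ge2_word_def)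
  then have "Y \<in> set w" using assms(2) hd_in_set by metis
  then obtain ks k where "decode w = ks @ [k]" "\<And>j. decode (w @ xpow j) = ks @ [k + j]"
    using decode_append_xpow by blast
  moreover have "last (w @ xpow j) = X" using w by (cases j) (auto simp: xpow_def last_append)
  ultimately show ?thesis using w assms(2) by (simp add: ge2_word_def)
qed

lemma ge2_word_append_yxpow:
  assumes "ge2_word w" "j > 0"
  shows "ge2_word (w @ yxpow j)"
proof -
  have "\<forall>k\<in>set (decode w). 2 \<le> k" using assms by (auto simp: ge2_word_def)
  then show ?thesis using assms
    by (auto simp: ge2_word_def decode_append_yxpow hd_append) (auto simp: yxpow_def)
qed

text \<open>Only tuples whose largest variable is Suc N contribute to the difference, and every
  appended \<open>x\<close> raises the exponent of that variable by one.\<close>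

lemma trunc_Zword_diff_append_xpow:
  assumes "ge2_word w" "w \<noteq> []"
  shows "trunc_Zword (Suc N) (w @ xpow j) - trunc_Zword N (w @ xpow j) = (1 / real (Suc N)) ^ j * (trunc_Zword (Suc N) w - trunc_Zword N w)"
proof -
  have "Y \<in> set w" using assms hd_in_set by (metis ge2_word_def)
  then obtain ks k where "decode w = ks @ [k]" "\<And>j. decode (w @ xpow j) = ks @ [k + j]"
    using decode_append_xpow by blast
  then show ?thesis by (simp add: trunc_Zword_def power_add power_divide)
qed

text \<open>The appended block owns the largest variable, which the difference pins to Suc N; the
  variables of w then range up to N.\<close>

lemma trunc_Zword_diff_append_yxpow:
  "trunc_Zword (Suc N) (w @ yxpow j) - trunc_Zword N (w @ yxpow j) = (1 / real (Suc N)) ^ Suc j * trunc_Zword N w"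
  by (simp add: trunc_Zword_def decode_append_yxpow power_divide)

section \<open>Linear functionals on noncommutative polynomials\<close>

definition lin_eval :: "(letter list \<Rightarrow> real) \<Rightarrow> ncpoly \<Rightarrow> real" where
  "lin_eval \<psi> p = (\<Sum>w\<in>{w. p w \<noteq> 0}. real_of_rat (p w) * \<psi> w)"

lemma lin_eval_superset:
  assumes "finite S" "{w. p w \<noteq> 0} \<subseteq> S"
  shows "lin_eval \<psi> p = (\<Sum>w\<in>S. real_of_rat (p w) * \<psi> w)"
  unfolding lin_eval_def by (rule sum.mono_neutral_left) (use assms in auto)

lemma lin_eval_add:
  assumes "finite {w. p w \<noteq> 0}" "finite {w. q w \<noteq> 0}"
  shows "lin_eval \<psi> (\<lambda>w. p w + q w) = lin_eval \<psi> p + lin_eval \<psi> q"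
proof -
  let ?S = "{w. p w \<noteq> 0} \<union> {w. q w \<noteq> 0}"
  have f: "finite ?S" using assms by simp
  have "lin_eval \<psi> (\<lambda>w. p w + q w) = (\<Sum>w\<in>?S. real_of_rat (p w + q w) * \<psi> w)"
    by (rule lin_eval_superset[OF f]) auto
  also have "\<dots> = lin_eval \<psi> p + lin_eval \<psi> q"
    by (subst (1 2) lin_eval_superset[OF f]) (auto simp: of_rat_add distrib_right sum.distrib)
  finally show ?thesis .
qed

lemma finite_supp_sum:
  fixes p :: "'i \<Rightarrow> 'a \<Rightarrow> 'b::comm_monoid_add"
  assumes "finite I" "\<And>i. i \<in> I \<Longrightarrow> finite {w. p i w \<noteq> 0}"
  shows "finite {w. (\<Sum>i\<in>I. p i w) \<noteq> 0}"
proof (rule finite_subset)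
  show "{w. (\<Sum>i\<in>I. p i w) \<noteq> 0} \<subseteq> (\<Union>i\<in>I. {w. p i w \<noteq> 0})"
    by (auto intro: sum.not_neutral_contains_not_neutral)
qed (use assms in auto)

lemma lin_eval_sum:
  assumes "finite I" "\<And>i. i \<in> I \<Longrightarrow> finite {w. p i w \<noteq> 0}"
  shows "lin_eval \<psi> (\<lambda>w. \<Sum>i\<in>I. p i w) = (\<Sum>i\<in>I. lin_eval \<psi> (p i))"
  using assms
proof (induction I rule: finite_induct)
  case empty
  then show ?case by (simp add: lin_eval_def)
next
  case (insert i I)
  then have "finite {w. (\<Sum>i\<in>I. p i w) \<noteq> 0}" by (intro finite_supp_sum) auto
  then show ?case using insert by (simp add: lin_eval_add)
qed

lemma lin_eval_scale: "lin_eval \<psi> (\<lambda>w. k * p w) = real_of_rat k * lin_eval \<psi> p"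
proof (cases "k = 0")
  case False
  then show ?thesis by (simp add: lin_eval_def of_rat_mult sum_distrib_left mult.assoc)
qed (simp add: lin_eval_def)

lemma pmult_mono_append: "pmult p (mono u) (v @ u) = p v"
proof -
  have "pmult p (mono u) (v @ u) = (\<Sum>i\<in>{length v}. p (take i (v @ u)) * mono u (drop i (v @ u)))"
    unfolding pmult_def
  proof (rule sum.mono_neutral_right)
    show "\<forall>i\<in>{..length (v @ u)} - {length v}. p (take i (v @ u)) * mono u (drop i (v @ u)) = 0"
    proof
      fix i assume i: "i \<in> {..length (v @ u)} - {length v}"
      have "drop i (v @ u) \<noteq> u"
      proof
        assume "drop i (v @ u) = u"
        then have "length (drop i (v @ u)) = length u" by simp
        then show False using i by auto
      qed
      then show "p (take i (v @ u)) * mono u (drop i (v @ u)) = 0" by (simp add: mono_def)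
    qed
  qed auto
  then show ?thesis by (simp add: mono_def)
qed

lemma supp_pmult_mono: "{w. pmult p (mono u) w \<noteq> 0} = (\<lambda>v. v @ u) ` {v. p v \<noteq> 0}"
proof (intro equalityI subsetI)
  fix w assume "w \<in> {w. pmult p (mono u) w \<noteq> 0}"
  then obtain i where "mono u (drop i w) \<noteq> 0" "pmult p (mono u) w \<noteq> 0"
    unfolding pmult_def using sum.not_neutral_contains_not_neutral[of "\<lambda>i. p (take i w) * mono u (drop i w)"]
    by (metis (mono_tags, lifting) mem_Collect_eq mult_not_zero)
  then have "w = take i w @ u" "pmult p (mono u) w \<noteq> 0"
    by (auto simp: mono_def split: if_splits)
  then show "w \<in> (\<lambda>v. v @ u) ` {v. p v \<noteq> 0}" using pmult_mono_append[of p u "take i w"] by force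
qed (auto simp: pmult_mono_append)

lemma lin_eval_pmult_mono: "lin_eval \<psi> (pmult p (mono u)) = lin_eval (\<lambda>w. \<psi> (w @ u)) p"
  unfolding lin_eval_def supp_pmult_mono by (subst sum.reindex) (auto simp: inj_on_def pmult_mono_append)

lemma lin_eval_cong: "(\<And>w. p w \<noteq> 0 \<Longrightarrow> \<psi> w = \<psi>' w) \<Longrightarrow> lin_eval \<psi> p = lin_eval \<psi>' p"
  by (simp add: lin_eval_def)

lemma lin_eval_diff: "lin_eval (\<lambda>w. \<psi> w - \<psi>' w) p = lin_eval \<psi> p - lin_eval \<psi>' p"
  by (simp add: lin_eval_def sum_subtractf right_diff_distrib)

lemma lin_eval_cmult: "lin_eval (\<lambda>w. k * \<psi> w) p = k * lin_eval \<psi> p"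
  by (simp add: lin_eval_def sum_distrib_left algebra_simps)

lemma lin_eval_mono: "lin_eval \<psi> (mono u) = \<psi> u"
proof -
  have "lin_eval \<psi> (mono u) = (\<Sum>w\<in>{u}. real_of_rat (mono u w) * \<psi> w)"
    by (rule lin_eval_superset) (auto simp: mono_def split: if_splits)
  then show ?thesis by (simp add: mono_def)
qed

section \<open>The recursion of D in terms of choices, and the support of D\<close>

lemma sum_choices_EO:
  assumes "even (length c)"
  shows "(\<Sum>A\<in>{A. A \<subseteq> ones c \<and> even_odd A}. \<Sum>B\<in>{B. B \<subseteq> bigs c \<and> m \<le> card A + card B \<and> noEO c B}. f A B)
    = (\<Sum>(A, B)\<in>{(A, B)\<in>choices True c. m \<le> card A + card B}. f A B)"
proof -
  have fin: "finite (ones c)" "finite (bigs c)" by (auto simp: ones_def bigs_def)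
  have "noEO c B \<longleftrightarrow> (\<forall>i\<in>B. even i \<longrightarrow> Suc i \<notin> B)" if "B \<subseteq> bigs c" for B
  proof
    assume n: "noEO c B"
    show "\<forall>i\<in>B. even i \<longrightarrow> Suc i \<notin> B"
    proof (intro ballI impI notI)
      fix i assume i: "i \<in> B" "even i" "Suc i \<in> B"
      then have "1 \<le> i" "Suc i \<le> length c" using that bigs_bounds by blast+
      then have "i div 2 \<in> {1..length c div 2 - 1}" using i(2) assms by auto
      then show False using n i by (auto simp: noEO_def)
    qed
  qed (auto simp: noEO_def)
  then have "(SIGMA A:{A. A \<subseteq> ones c \<and> even_odd A}. {B. B \<subseteq> bigs c \<and> m \<le> card A + card B \<and> noEO c B})
      = {(A, B)\<in>choices True c. m \<le> card A + card B}"
    by (auto simp: choices_def even_odd_def)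
  then show ?thesis using fin by (subst sum.Sigma) (auto simp: case_prod_beta)
qed

lemma sum_choices_OE:
  assumes "even (length c)"
  shows "(\<Sum>A\<in>{A. A \<subseteq> ones c \<and> odd_even A}. \<Sum>B\<in>{B. B \<subseteq> bigs c \<and> m \<le> card A + card B \<and> noOE c B}. f A B)
    = (\<Sum>(A, B)\<in>{(A, B)\<in>choices False c. m \<le> card A + card B}. f A B)"
proof -
  have fin: "finite (ones c)" "finite (bigs c)" by (auto simp: ones_def bigs_def)
  have "noOE c B \<longleftrightarrow> (\<forall>i\<in>B. odd i \<longrightarrow> Suc i \<notin> B)" if "B \<subseteq> bigs c" for B
  proof
    assume n: "noOE c B"
    show "\<forall>i\<in>B. odd i \<longrightarrow> Suc i \<notin> B"
    proof (intro ballI impI notI)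
      fix i assume i: "i \<in> B" "odd i" "Suc i \<in> B"
      then have "Suc i \<le> length c" using that bigs_bounds by blast
      then have "Suc i div 2 \<in> {1..length c div 2}" "2 * (Suc i div 2) = Suc i" using i(2) by (auto elim!: oddE)
      then show False using n i unfolding noOE_def by (metis diff_Suc_1 empty_subsetI insert_subset)
    qed
  next
    assume n: "\<forall>i\<in>B. odd i \<longrightarrow> Suc i \<notin> B"
    show "noOE c B" unfolding noOE_def
    proof
      fix r assume "r \<in> {1..length c div 2}"
      then show "\<not> {2 * r - 1, 2 * r} \<subseteq> B" using n[rule_format, of "2 * r - 1"] by auto
    qed
  qed
  then have "(SIGMA A:{A. A \<subseteq> ones c \<and> odd_even A}. {B. B \<subseteq> bigs c \<and> m \<le> card A + card B \<and> noOE c B})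
      = {(A, B)\<in>choices False c. m \<le> card A + card B}"
    by (auto simp: choices_def odd_even_def)
  then show ?thesis using fin by (subst sum.Sigma) (auto simp: case_prod_beta)
qed

text \<open>What an induction on the fuel asks for: the weight drops by #A + #B, while parity and
  positivity are kept so that the hypothesis applies to the reduced index.\<close>

definition reduce_invariant :: "nat list \<Rightarrow> nat set \<Rightarrow> nat set \<Rightarrow> bool" where
  "reduce_invariant c A B \<longleftrightarrow> even (length (reduce c A B)) = even (length c) \<and>
     ((\<forall>k\<in>set c. k > 0) \<longrightarrow> (\<forall>k\<in>set (reduce c A B). k > 0)) \<and>
     sum_list (reduce c A B) + card A + card B = sum_list c"

lemma choices_notin:
  assumes "(A, B) \<in> choices p c" "n > length c"
  shows "n \<notin> A" "n \<notin> B" "finite A" "finite B"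
  using choices_bounds[OF assms(1)] assms(2) finite_subset by fastforce+

lemma reduce_invariant_snoc2:
  assumes "even (Suc (length c)) = p" "(A, B) \<in> choices p (c @ [a, b])"
    and IH: "\<And>A B. (A, B) \<in> choices p c \<Longrightarrow> reduce_invariant c A B"
  shows "reduce_invariant (c @ [a, b]) A B"
proof -
  from assms(2) obtain A0 B0 where AB: "(A0, B0) \<in> choices p c"
    and d: "(A = A0 \<and> B = B0) \<or> (a > 1 \<and> A = A0 \<and> B = insert (Suc (length c)) B0) \<or>
      (b > 1 \<and> A = A0 \<and> B = insert (Suc (Suc (length c))) B0) \<or>
      (a = 1 \<and> b = 1 \<and> A = insert (Suc (length c)) (insert (Suc (Suc (length c))) A0) \<and> B = B0)"
    unfolding choices_snoc2[OF assms(1)] by (auto split: if_splits)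
  have "reduce_invariant c A0 B0" using IH AB .
  then show ?thesis using d choices_notin[OF AB, of "Suc (length c)"] choices_notin[OF AB, of "Suc (Suc (length c))"]
    by (elim disjE conjE) (auto simp: reduce_invariant_def reduce_snoc2)
qed

lemma reduce_invariant_snoc:
  assumes "even (Suc (length c)) = p" "(A, B) \<in> choices p (c @ [a])"
    and IH: "\<And>A B. (A, B) \<in> choices p c \<Longrightarrow> reduce_invariant c A B"
  shows "reduce_invariant (c @ [a]) A B"
proof -
  from assms(2) obtain A0 B0 where AB: "(A0, B0) \<in> choices p c"
    and d: "(A = A0 \<and> B = B0) \<or> (a > 1 \<and> A = A0 \<and> B = insert (Suc (length c)) B0)"
    unfolding choices_snoc[OF assms(1)] by (auto split: if_splits)
  have "reduce_invariant c A0 B0" using IH AB .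
  then show ?thesis using d choices_notin[OF AB, of "Suc (length c)"]
    by (elim disjE conjE) (auto simp: reduce_invariant_def reduce_snoc)
qed

lemma reduce_invariant_False:
  assumes "even (length c)" "(A, B) \<in> choices False c"
  shows "reduce_invariant c A B"
  using assms
proof (induction c arbitrary: A B rule: parity_snoc2_induct)
  case Nil
  then show ?case by (simp add: choices_Nil reduce_invariant_def reduce_def)
next
  case (snoc2 c a b)
  show ?case by (rule reduce_invariant_snoc2[OF _ snoc2.prems snoc2.IH]) (use snoc2.hyps in simp)
qed

text \<open>Even-odd pairs fill up indices of odd length, so the last position is split off
  first.\<close>

lemma reduce_invariant_True:
  assumes "even (length c)" "(A, B) \<in> choices True c"
  shows "reduce_invariant c A B"
proof (cases c rule: rev_cases)
  case Nil
  then show ?thesis using assms by (simp add: choices_Nil reduce_invariant_def reduce_def)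
next
  case (snoc d a)
  have "reduce_invariant d A B" if "(A, B) \<in> choices True d" "odd (length d)" for A B
    using that(2,1)
  proof (induction d arbitrary: A B rule: parity_snoc2_induct_odd)
    case (single a)
    have r: "reduce [a] A B = (if 1 \<in> A then [] else [a - (if 1 \<in> B then 1 else 0)])" for A B
      using reduce_snoc[of "[]" a A B] by (simp add: reduce_def)
    show ?case using single by (auto simp: choices_single reduce_invariant_def r split: if_splits)
  next
    case (snoc2 c a b)
    show ?case by (rule reduce_invariant_snoc2[OF _ snoc2.prems snoc2.IH]) (use snoc2.hyps in simp)
  qed
  then show ?thesis using assms snoc by (auto intro!: reduce_invariant_snoc)
qed

text \<open>Position 1 survives, since its even-odd partner would be position 0. Hence a power of x
  is never appended to the empty word, which would lead out of H^{>=2}.\<close>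

lemma reduce_ne_Nil:
  assumes "(A, B) \<in> choices True c" "c \<noteq> []"
  shows "reduce c A B \<noteq> []"
proof -
  have "1 \<notin> A"
  proof
    assume "1 \<in> A"
    then have "0 \<in> A" using assms(1) by (auto simp: choices_def dest!: bspec[of A _ 1])
    then show False using choices_bounds(1)[OF assms(1)] by auto
  qed
  moreover have "[1..<length c + 1] = 1 # [2..<length c + 1]"
    using assms(2) by (simp add: upt_conv_Cons numeral_2_eq_2 del: upt_Suc)
  ultimately show ?thesis unfolding reduce_def by simp
qed

lemma choices_card_0:
  "{(A, B)\<in>choices p c. card A + card B = 0} = {({}, {})}"
proof -
  have "A = {} \<and> B = {}" if "(A, B) \<in> choices p c" "card A + card B = 0" for A B
    using choices_notin(3,4)[OF that(1), of "Suc (length c)"] that(2) by auto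
  moreover have "({}, {}) \<in> choices p c" by (auto simp: choices_def)
  ultimately show ?thesis by auto
qed

text \<open>A deleted position brings its partner along, so size 1 can only come from B. The result
  is independent of p, which lets terms of the two parities be exchanged.\<close>

lemma choices_card_1:
  "{(A, B)\<in>choices p c. card A + card B = 1} = (\<lambda>i. ({}, {i})) ` bigs c"
proof -
  have "A = {} \<and> (\<exists>i\<in>bigs c. B = {i})" if AB: "(A, B) \<in> choices p c" "card A + card B = 1" for A B
  proof -
    have fin: "finite A" "finite B" using choices_notin(3,4)[OF AB(1), of "Suc (length c)"] by auto
    have "card A \<noteq> 1"
    proof
      assume "card A = 1"
      then obtain a where a: "A = {a}" by (auto simp: card_Suc_eq)
      then have "a \<ge> 1" using choices_bounds(1)[OF AB(1)] by auto
      then show False using AB(1) a by (auto simp: choices_def split: if_splits)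
    qed
    then have "card A = 0" "card B = 1" using AB(2) by auto
    then have "A = {}" "card B = 1" using fin by auto
    then show ?thesis using AB(1) by (auto simp: card_Suc_eq choices_def)
  qed
  moreover have "({}, {i}) \<in> choices p c" if "i \<in> bigs c" for i
    using that by (auto simp: choices_def)
  ultimately show ?thesis by auto
qed

lemma Dfuel_Suc_choices:
  assumes "even (length c)" "c \<noteq> []"
  shows "Dfuel (Suc n) c = (\<lambda>w.
      (\<Sum>(A, B)\<in>{(A, B)\<in>choices True c. 1 \<le> card A + card B}.
           (-1) ^ (card B + 1) * pmult (Dfuel n (reduce c A B)) (mono (xpow (card A + card B))) w)
    + (\<Sum>(A, B)\<in>{(A, B)\<in>choices True c. 2 \<le> card A + card B}.
           (-1) ^ (card B + 1) * pmult (Dfuel n (reduce c A B)) (mono (yxpow (card A + card B - 1))) w)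
    + (\<Sum>(A, B)\<in>{(A, B)\<in>choices False c. 2 \<le> card A + card B}.
           (-1) ^ (card B) * pmult (Dfuel n (reduce c A B)) (mono (yxpow (card A + card B - 1))) w))"
  using assms(2) unfolding Dfuel.simps sum_choices_EO[OF assms(1)] sum_choices_OE[OF assms(1)] by simp

text \<open>D takes values in H^{>=2} because each appended factor is harmless: powers of x go onto
  nonempty words, and the factors starting with y contain an x since their sums start at #A + #B =
  2.\<close>

lemma supp_Dfuel:
  assumes "even (length c)" "Dfuel n c w \<noteq> 0"
  shows "ge2_word w \<and> (c \<noteq> [] \<longrightarrow> w \<noteq> [])"
  using assms
proof (induction n arbitrary: c w)
  case (Suc n)
  show ?case
  proof (cases "c = []")
    case True
    then show ?thesis using Suc.prems by (auto simp: mono_def ge2_word_def split: if_splits)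
  next
    case False
    have step: "\<exists>A B v. (A, B) \<in> choices p c \<and> Dfuel n (reduce c A B) v \<noteq> 0 \<and> m \<le> card A + card B \<and> w = v @ u A B"
      if ne: "(\<Sum>(A, B)\<in>{(A, B)\<in>choices p c. m \<le> card A + card B}. f B * pmult (Dfuel n (reduce c A B)) (mono (u A B)) w) \<noteq> 0"
      for p m u and f :: "nat set \<Rightarrow> rat"
    proof -
      obtain z where z: "z \<in> {(A, B)\<in>choices p c. m \<le> card A + card B}"
        "(case z of (A, B) \<Rightarrow> f B * pmult (Dfuel n (reduce c A B)) (mono (u A B)) w) \<noteq> 0"
        using sum.not_neutral_contains_not_neutral[OF ne] by blast
      obtain A B where AB: "z = (A, B)" by force
      then have "w \<in> {w. pmult (Dfuel n (reduce c A B)) (mono (u A B)) w \<noteq> 0}" using z by auto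
      then show ?thesis using z unfolding supp_pmult_mono AB by auto
    qed
    have "Dfuel (Suc n) c w \<noteq> 0" by (rule Suc.prems)
    then consider (1) "(\<Sum>(A, B)\<in>{(A, B)\<in>choices True c. 1 \<le> card A + card B}.
           (-1) ^ (card B + 1) * pmult (Dfuel n (reduce c A B)) (mono (xpow (card A + card B))) w) \<noteq> 0"
      | (2) "(\<Sum>(A, B)\<in>{(A, B)\<in>choices True c. 2 \<le> card A + card B}.
           (-1) ^ (card B + 1) * pmult (Dfuel n (reduce c A B)) (mono (yxpow (card A + card B - 1))) w) \<noteq> 0"
      | (3) "(\<Sum>(A, B)\<in>{(A, B)\<in>choices False c. 2 \<le> card A + card B}.
           (-1) ^ (card B) * pmult (Dfuel n (reduce c A B)) (mono (yxpow (card A + card B - 1))) w) \<noteq> 0"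
      unfolding Dfuel_Suc_choices[OF Suc.prems(1) False] by force
    then show ?thesis
    proof cases
      case 1
      then obtain A B v where v: "(A, B) \<in> choices True c" "Dfuel n (reduce c A B) v \<noteq> 0"
        "w = v @ xpow (card A + card B)"
        using step[where p = True and m = 1 and f = "\<lambda>B. (-1) ^ (card B + 1)" and u = "\<lambda>A B. xpow (card A + card B)"] by blast
      have "even (length (reduce c A B))"
        using reduce_invariant_True[OF Suc.prems(1) v(1)] Suc.prems(1) by (simp add: reduce_invariant_def)
      then have "ge2_word v" "v \<noteq> []" using Suc.IH[OF _ v(2)] reduce_ne_Nil[OF v(1) False] by auto
      then show ?thesis using ge2_word_append_xpow v(3) by auto
    next
      case 2
      then obtain A B v where v: "(A, B) \<in> choices True c" "Dfuel n (reduce c A B) v \<noteq> 0"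
        "2 \<le> card A + card B" "w = v @ yxpow (card A + card B - 1)" 
        using step[where p = True and m = 2 and f = "\<lambda>B. (-1) ^ (card B + 1)" and u = "\<lambda>A B. yxpow (card A + card B - 1)"] by blast
      have "even (length (reduce c A B))"
        using reduce_invariant_True[OF Suc.prems(1) v(1)] Suc.prems(1) by (simp add: reduce_invariant_def)
      then have "ge2_word v" using Suc.IH[OF _ v(2)] by auto
      then show ?thesis using ge2_word_append_yxpow[of v "card A + card B - 1"] v(3,4) by (auto simp: yxpow_def)
    next
      case 3
      then obtain A B v where v: "(A, B) \<in> choices False c" "Dfuel n (reduce c A B) v \<noteq> 0"
        "2 \<le> card A + card B" "w = v @ yxpow (card A + card B - 1)" 
        using step[where p = False and m = 2 and f = "\<lambda>B. (-1) ^ (card B)" and u = "\<lambda>A B. yxpow (card A + card B - 1)"] by blast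
      have "even (length (reduce c A B))"
        using reduce_invariant_False[OF Suc.prems(1) v(1)] Suc.prems(1) by (simp add: reduce_invariant_def)
      then have "ge2_word v" using Suc.IH[OF _ v(2)] by auto
      then show ?thesis using ge2_word_append_yxpow[of v "card A + card B - 1"] v(3,4) by (auto simp: yxpow_def)
    qed
  qed
qed simp

lemma finite_supp_term:
  assumes "finite {w. p w \<noteq> 0}"
  shows "finite {w. (k::rat) * pmult p (mono u) w \<noteq> 0}"
proof (rule finite_subset)
  show "{w. k * pmult p (mono u) w \<noteq> 0} \<subseteq> {w. pmult p (mono u) w \<noteq> 0}" by auto
qed (use assms in \<open>simp add: supp_pmult_mono\<close>)

lemma finite_supp_add:
  assumes "finite {w. p w \<noteq> 0}" "finite {w. q w \<noteq> 0}"
  shows "finite {w. p w + q w \<noteq> (0::rat)}"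
  by (rule finite_subset[of _ "{w. p w \<noteq> 0} \<union> {w. q w \<noteq> 0}"]) (use assms in auto)

lemma finite_choices_if: "finite {(A, B)\<in>choices p c. m \<le> card A + card B}"
  by (rule finite_subset[OF _ finite_choices[of p c]]) auto

lemma finite_supp_Dfuel: "finite {w. Dfuel n c w \<noteq> 0}"
proof (induction n arbitrary: c)
  case (Suc n)
  have fin: "finite (ones c)" "finite (bigs c)" by (auto simp: ones_def bigs_def)
  show ?case
  proof (cases "c = []")
    case True
    then show ?thesis by (simp add: mono_def)
  next
    case False
    have "finite {w. (\<Sum>A\<in>{A. A \<subseteq> ones c \<and> P A}. \<Sum>B\<in>{B. B \<subseteq> bigs c \<and> Q A B}.
      f B * pmult (Dfuel n (reduce c A B)) (mono (u A B)) w) \<noteq> 0}" for P Q u and f :: "nat set \<Rightarrow> rat"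
      by (intro finite_supp_sum finite_supp_term Suc.IH) (use fin in auto)
    then show ?thesis using False by (simp only: Dfuel.simps if_False) (intro finite_supp_add)
  qed
qed simp

section \<open>Truncated values of D\<close>

lemma lin_eval_choice_sum:
  assumes "\<And>d. finite {w. p d w \<noteq> 0}"
  shows "lin_eval \<psi> (\<lambda>w. \<Sum>(A, B)\<in>{(A, B)\<in>choices b c. m \<le> card A + card B}.
       f B * pmult (p (reduce c A B)) (mono (u A B)) w) =
     (\<Sum>(A, B)\<in>{(A, B)\<in>choices b c. m \<le> card A + card B}.
       real_of_rat (f B) * lin_eval (\<lambda>w. \<psi> (w @ u A B)) (p (reduce c A B)))"
proof -
  have "finite {w. (case z of (A, B) \<Rightarrow> f B * pmult (p (reduce c A B)) (mono (u A B)) w) \<noteq> 0}" for z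
    by (cases z) (simp only: prod.case, rule finite_supp_term, rule assms)
  then have "lin_eval \<psi> (\<lambda>w. \<Sum>z\<in>{(A, B)\<in>choices b c. m \<le> card A + card B}.
       (case z of (A, B) \<Rightarrow> f B * pmult (p (reduce c A B)) (mono (u A B)) w)) =
     (\<Sum>z\<in>{(A, B)\<in>choices b c. m \<le> card A + card B}.
        lin_eval \<psi> (\<lambda>w. case z of (A, B) \<Rightarrow> f B * pmult (p (reduce c A B)) (mono (u A B)) w))"
    by (intro lin_eval_sum finite_choices_if)
  also have "\<dots> = (\<Sum>z\<in>{(A, B)\<in>choices b c. m \<le> card A + card B}.
       (case z of (A, B) \<Rightarrow> real_of_rat (f B) * lin_eval (\<lambda>w. \<psi> (w @ u A B)) (p (reduce c A B))))"
    by (rule sum.cong) (auto simp: lin_eval_scale lin_eval_pmult_mono)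
  finally show ?thesis .
qed

lemma finite_supp_choice_sum:
  assumes "\<And>d. finite {w. p d w \<noteq> 0}"
  shows "finite {w. (\<Sum>(A, B)\<in>{(A, B)\<in>choices b c. m \<le> card A + card B}.
     (f B::rat) * pmult (p (reduce c A B)) (mono (u A B)) w) \<noteq> 0}"
proof -
  have "finite {w. (case z of (A, B) \<Rightarrow> f B * pmult (p (reduce c A B)) (mono (u A B)) w) \<noteq> 0}" for z
    by (cases z) (simp only: prod.case, rule finite_supp_term, rule assms)
  then show ?thesis by (intro finite_supp_sum finite_choices_if)
qed

lemma lin_eval_Dfuel_Suc:
  assumes "even (length c)" "c \<noteq> []"
  shows "lin_eval \<psi> (Dfuel (Suc n) c) =
      (\<Sum>(A, B)\<in>{(A, B)\<in>choices True c. 1 \<le> card A + card B}.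
           (-1) ^ (card B + 1) * lin_eval (\<lambda>w. \<psi> (w @ xpow (card A + card B))) (Dfuel n (reduce c A B)))
    + (\<Sum>(A, B)\<in>{(A, B)\<in>choices True c. 2 \<le> card A + card B}.
           (-1) ^ (card B + 1) * lin_eval (\<lambda>w. \<psi> (w @ yxpow (card A + card B - 1))) (Dfuel n (reduce c A B)))
    + (\<Sum>(A, B)\<in>{(A, B)\<in>choices False c. 2 \<le> card A + card B}.
           (-1) ^ (card B) * lin_eval (\<lambda>w. \<psi> (w @ yxpow (card A + card B - 1))) (Dfuel n (reduce c A B)))"
proof -
  note f = finite_supp_choice_sum[of "Dfuel n", OF finite_supp_Dfuel]
  show ?thesis
    unfolding Dfuel_Suc_choices[OF assms]
    by (subst lin_eval_add[OF finite_supp_add[OF f f] f], subst lin_eval_add[OF f f])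
      (simp only: lin_eval_choice_sum[of "Dfuel n", OF finite_supp_Dfuel] of_rat_power of_rat_minus of_rat_1)
qed

lemma sum_choices_split:
  fixes t :: "nat set \<Rightarrow> nat set \<Rightarrow> real"
  shows "(\<Sum>(A, B)\<in>choices p c. t A B) = t {} {} + (\<Sum>(A, B)\<in>{(A, B)\<in>choices p c. 1 \<le> card A + card B}. t A B)"
    and "(\<Sum>(A, B)\<in>{(A, B)\<in>choices p c. 1 \<le> card A + card B}. t A B) = (\<Sum>i\<in>bigs c. t {} {i})
      + (\<Sum>(A, B)\<in>{(A, B)\<in>choices p c. 2 \<le> card A + card B}. t A B)"
proof -
  let ?C = "\<lambda>m. {(A, B)\<in>choices p c. m \<le> card A + card B}"
  have 0: "choices p c = {({}, {})} \<union> ?C 1" "{({}, {})} \<inter> ?C 1 = {}"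
    unfolding choices_card_0[where p = p and c = c, symmetric] by auto
  have 1: "?C 1 = (\<lambda>i. ({}, {i})) ` bigs c \<union> ?C 2" "(\<lambda>i. ({}, {i})) ` bigs c \<inter> ?C 2 = {}"
    unfolding choices_card_1[where p = p and c = c, symmetric] by auto
  have fb: "finite (bigs c)" by (auto simp: bigs_def)
  show "(\<Sum>(A, B)\<in>choices p c. t A B) = t {} {} + (\<Sum>(A, B)\<in>?C 1. t A B)"
    by (subst 0(1), subst sum.union_disjoint[OF _ finite_choices_if 0(2)]) auto
  show "(\<Sum>(A, B)\<in>?C 1. t A B) = (\<Sum>i\<in>bigs c. t {} {i}) + (\<Sum>(A, B)\<in>?C 2. t A B)"
    by (subst 1(1), subst sum.union_disjoint[OF _ finite_choices_if 1(2)])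
      (use fb in \<open>auto simp: sum.reindex inj_on_def\<close>)
qed

lemma reduce_empty: "reduce c {} {} = c"
  by (induction c rule: rev_induct) (auto simp: reduce_snoc reduce_def[of "[]"])

text \<open>Induction on the fuel and, inside it, on N. For nonempty c both sides vanish at N = 0;
  the increment uses the fuel hypothesis at both N and Suc N.\<close>

lemma lin_eval_trunc_Zword_Dfuel:
  assumes "even (length c)" "\<forall>k\<in>set c. k > 0" "sum_list c < n"
  shows "lin_eval (trunc_Zword N) (Dfuel n c) = chain_sum (Suc N) (rev c) N"
  using assms
proof (induction n arbitrary: c N)
  case (Suc n)
  show ?case
  proof (cases "c = []")
    case True
    then show ?thesis by (simp add: lin_eval_mono trunc_Zword_def)
  next
    case False
    have IH: "lin_eval (trunc_Zword N) (Dfuel n (reduce c A B)) = chain_sum (Suc N) (rev (reduce c A B)) N"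
      if "reduce_invariant c A B" "1 \<le> card A + card B" for A B N
      using that Suc.prems by (intro Suc.IH) (auto simp: reduce_invariant_def)
    show ?thesis
    proof (induction N)
      case 0
      have "trunc_Zword 0 w = 0" if "Dfuel (Suc n) c w \<noteq> 0" for w
      proof -
        have "ge2_word w" "w \<noteq> []" using supp_Dfuel[OF Suc.prems(1) that] False by auto
        then have "Y \<in> set w" by (metis ge2_word_def hd_in_set)
        then show ?thesis using decode_append_xpow[of w] by (auto simp: trunc_Zword_def)
      qed
      then have "lin_eval (trunc_Zword 0) (Dfuel (Suc n) c) = lin_eval (\<lambda>_. 0) (Dfuel (Suc n) c)" by (rule lin_eval_cong)
      also have "\<dots> = 0" by (simp add: lin_eval_def)
      also have "chain_sum (Suc 0) (rev c) 0 = 0"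
        using False Suc.prems(2) by (cases c rule: rev_cases) (simp_all add: chain_sum_zero)
      ultimately show ?case by simp
    next
      case (Suc N)
      let ?h = "1 / real (Suc N)"
      define F where "F = (\<lambda>N A B. chain_sum (Suc N) (rev (reduce c A B)) N)"
      define t where "t = (\<lambda>N A B. (-1) ^ card B * ?h ^ (card A + card B) * F N A B)"
      let ?C = "\<lambda>p m. {(A, B)\<in>choices p c. m \<le> card A + card B}"
      have even: "even (length c)" by fact
      have evred: "even (length (reduce c A B))" if "(A, B) \<in> choices p c" for A B p
        using reduce_invariant_True[OF even, of A B] reduce_invariant_False[OF even, of A B] that even
        by (cases p) (auto simp: reduce_invariant_def)
      have adm: "reduce_invariant c A B" if "(A, B) \<in> choices p c" for A B p
        using reduce_invariant_True[OF even, of A B] reduce_invariant_False[OF even, of A B] that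
        by (cases p) auto
      have x: "lin_eval (\<lambda>w. trunc_Zword (Suc N) (w @ xpow j) - trunc_Zword N (w @ xpow j)) (Dfuel n (reduce c A B))
          = ?h ^ j * (F (Suc N) A B - F N A B)"
        if "(A, B) \<in> choices True c" "1 \<le> card A + card B" for A B j
      proof -
        have "lin_eval (\<lambda>w. trunc_Zword (Suc N) (w @ xpow j) - trunc_Zword N (w @ xpow j)) (Dfuel n (reduce c A B))
          = lin_eval (\<lambda>w. ?h ^ j * (trunc_Zword (Suc N) w - trunc_Zword N w)) (Dfuel n (reduce c A B))"
          by (rule lin_eval_cong, rule trunc_Zword_diff_append_xpow)
            (use supp_Dfuel[OF evred[OF that(1)]] reduce_ne_Nil[OF that(1) False] in auto)
        then show ?thesis using IH[OF adm[OF that(1)] that(2)] by (simp add: lin_eval_cmult lin_eval_diff F_def)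
      qed
      have yx: "lin_eval (\<lambda>w. trunc_Zword (Suc N) (w @ yxpow (card A + card B - 1)) - trunc_Zword N (w @ yxpow (card A + card B - 1)))
           (Dfuel n (reduce c A B)) = ?h ^ (card A + card B) * F N A B"
        if "(A, B) \<in> choices p c" "2 \<le> card A + card B" for A B p
      proof -
        have "Suc (card A + card B - 1) = card A + card B" using that(2) by simp
        then show ?thesis using IH[OF adm[OF that(1)]] that(2)
          by (simp only: trunc_Zword_diff_append_yxpow lin_eval_cmult F_def)
      qed
      have "lin_eval (trunc_Zword (Suc N)) (Dfuel (Suc n) c) - lin_eval (trunc_Zword N) (Dfuel (Suc n) c)
        = lin_eval (\<lambda>w. trunc_Zword (Suc N) w - trunc_Zword N w) (Dfuel (Suc n) c)"
        by (simp only: lin_eval_diff)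
      \<comment> \<open>Words ending in an appended power of x contribute differences of
        \<open>F\<close>; those with a newly appended y contribute \<open>F\<close> at N
        alone.\<close>
      also have "\<dots> = (\<Sum>(A, B)\<in>?C True 1. t N A B - t (Suc N) A B)
          + (\<Sum>(A, B)\<in>?C True 2. - t N A B) + (\<Sum>(A, B)\<in>?C False 2. t N A B)"
        unfolding lin_eval_Dfuel_Suc[OF even False]
        by (intro arg_cong2[where f = "(+)"] sum.cong)
          (auto simp: x yx[unfolded One_nat_def] t_def algebra_simps simp del: of_nat_Suc)
      also have "\<dots> = (\<Sum>(A, B)\<in>?C True 1. t N A B) - (\<Sum>(A, B)\<in>?C True 1. t (Suc N) A B)
          - (\<Sum>(A, B)\<in>?C True 2. t N A B) + (\<Sum>(A, B)\<in>?C False 2. t N A B)"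
        by (simp add: case_prod_beta sum_subtractf sum_negf)
      \<comment> \<open>The size-1 terms agree for both parities, so the sums at N collapse to the
        full odd-even sum without its empty choice. The sum at Suc N is the full even-odd sum
        without its empty choice, and the full sums cancel.\<close>
      also have "\<dots> = t (Suc N) {} {} - t N {} {}"
      proof -
        have "(\<Sum>(A, B)\<in>choices True c. t (Suc N) A B) = (\<Sum>(A, B)\<in>choices False c. t N A B)"
          using EO_sum_eq_OE_sum[OF even, of "Suc N"] Suc.prems False \<open>\<forall>k\<in>set c. 0 < k\<close>
          by (simp add: choice_sum_def t_def F_def)
        then show ?thesis
          using sum_choices_split[of "t (Suc N)" True c] sum_choices_split[of "t N" True c]
            sum_choices_split[of "t N" False c] by linarith
      qed
      also have "\<dots> = chain_sum (Suc (Suc N)) (rev c) (Suc N) - chain_sum (Suc N) (rev c) N"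
        by (simp add: t_def F_def reduce_empty)
      finally show ?case using Suc.IH by linarith
    qed
  qed
qed simp

section \<open>Strict chain sums are truncated multiple zeta values\<close>

text \<open>Words are read from right to left, as the index of \<open>trunc_mzv\<close>.\<close>
fun strict_chain_sum :: "nat \<Rightarrow> letter list \<Rightarrow> nat \<Rightarrow> real" where
  "strict_chain_sum M [] n = 1"
| "strict_chain_sum M (X # w) n = (\<Sum>m = 1..n. 1 / real m * strict_chain_sum M w m)"
| "strict_chain_sum M (Y # w) n = (\<Sum>m = 1..n. 1 / (real M - real m) * strict_chain_sum M w (m - 1))"

lemma strict_chain_sum_zero: "w \<noteq> [] \<Longrightarrow> strict_chain_sum M w 0 = 0"
  by (cases "(M, w, 0::nat)" rule: strict_chain_sum.cases) auto

lemma strict_chain_sum_X: "strict_chain_sum M (X # w) (Suc n) = strict_chain_sum M (X # w) n + strict_chain_sum M w (Suc n) / real (Suc n)"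
  by simp

lemma strict_chain_sum_Y: "strict_chain_sum M (Y # w) (Suc n) =
    strict_chain_sum M (Y # w) n + strict_chain_sum M w n / (real M - real (Suc n))"
  by simp

declare strict_chain_sum.simps(2,3) [simp del]

text \<open>Raising M by one shifts the \<open>y\<close> weights, at a cost of 1/N whose sign
  depends on the top letter. The two claims are proved together because removing that letter may
  expose either kind. For \<open>x\<close> the empty word is excluded: a word of letters
  \<open>x\<close> alone has a sum independent of M.\<close>

lemma strict_chain_sum_shift:
  assumes "w = [] \<or> last w = Y"
  shows "w \<noteq> [] \<Longrightarrow> n < N \<Longrightarrow>
      strict_chain_sum (Suc N) (X # w) n = strict_chain_sum N (X # w) n - strict_chain_sum N w n / N"
    and "n < N \<Longrightarrow>
      strict_chain_sum (Suc N) (Y # w) (Suc n) = strict_chain_sum N (Y # w) n + strict_chain_sum N w n / N"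
proof -
  have "(w \<noteq> [] \<longrightarrow> (\<forall>n<N. strict_chain_sum (Suc N) (X # w) n = strict_chain_sum N (X # w) n - strict_chain_sum N w n / N)) \<and>
      (\<forall>n<N. strict_chain_sum (Suc N) (Y # w) (Suc n) = strict_chain_sum N (Y # w) n + strict_chain_sum N w n / N)"
    using assms
  proof (induction w)
    case Nil
    have "strict_chain_sum (Suc N) [Y] (Suc n) = strict_chain_sum N [Y] n + 1 / N" if "n < N" for n
      using that
    proof (induction n)
      case 0
      then show ?case by (simp add: strict_chain_sum_Y strict_chain_sum_zero)
    next
      case (Suc n)
      then show ?case using strict_chain_sum_Y[of "Suc N" "[]" "Suc n"] strict_chain_sum_Y[of N "[]" n] by simp
    qed
    then show ?case by simp
  next
    case (Cons l v)
    let ?w = "l # v" and ?a = "strict_chain_sum (Suc N)" and ?b = "strict_chain_sum N"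
    have v: "v = [] \<or> last v = Y" using Cons.prems by (auto split: if_splits)
    have pf: "z / m / (N' - m) = 1 / N' * z / (N' - m) + 1 / N' * z / m"
      if "N' \<noteq> 0" "m \<noteq> 0" "N' - m \<noteq> 0" for z N' m :: real
      using that by (simp add: divide_simps) (simp add: algebra_simps)
    have nz: "real N \<noteq> 0" "real (Suc n) \<noteq> 0" "real N - real (Suc n) \<noteq> 0" if "Suc n < N" for n
      using that by (auto simp del: of_nat_Suc)
    have lX: "l = X \<Longrightarrow> v \<noteq> []" using Cons.prems by auto
    have IHX: "?a ?w (Suc n) = ?b ?w n + ?b v (Suc n) / real (Suc n) - ?b v (Suc n) / N"
      "?b ?w (Suc n) = ?b ?w n + ?b v (Suc n) / real (Suc n)" if "l = X" "Suc n < N" for n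
      using Cons.IH v lX that strict_chain_sum_X[of N v n] by (auto simp del: of_nat_Suc)
    have IHY: "?a ?w (Suc n) = ?b ?w n + ?b v n / N"
      "?b ?w (Suc n) = ?b ?w n + ?b v n / (real N - real (Suc n))" if "l = Y" "Suc n < N" for n
      using Cons.IH v that strict_chain_sum_Y[of N v n] by (auto simp del: of_nat_Suc)
    have X: "?a (X # ?w) n = ?b (X # ?w) n - ?b ?w n / N" if "n < N" for n
      using that
    proof (induction n)
      case 0
      then show ?case by (simp add: strict_chain_sum_zero)
    next
      case (Suc n)
      \<comment> \<open>The comparison of increments in n; the last difference belongs to the
        correction \<open>?b ?w n / N\<close>.\<close>
      have "?a ?w (Suc n) / real (Suc n) = ?b ?w (Suc n) / real (Suc n) - (?b ?w (Suc n) - ?b ?w n) / N"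
      proof (cases l)
        case X
        show ?thesis using IHX[OF X Suc.prems]
          by (simp add: add_divide_distrib diff_divide_distrib mult.commute del: of_nat_Suc)
      next
        case Y
        show ?thesis using IHY[OF Y Suc.prems] pf[OF nz[OF Suc.prems], of "?b v n"]
          by (simp add: add_divide_distrib diff_divide_distrib mult.commute del: of_nat_Suc)
      qed
      then show ?case using Suc by (simp add: strict_chain_sum_X diff_divide_distrib del: of_nat_Suc)
    qed
    have Y: "?a (Y # ?w) (Suc n) = ?b (Y # ?w) n + ?b ?w n / N" if "n < N" for n
      using that
    proof (induction n)
      case 0
      then show ?case by (simp add: strict_chain_sum_Y strict_chain_sum_zero)
    next
      case (Suc n)
      have "?a ?w (Suc n) / (real N - real (Suc n)) =
          ?b ?w n / (real N - real (Suc n)) + (?b ?w (Suc n) - ?b ?w n) / N"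
      proof (cases l)
        case X
        show ?thesis using IHX[OF X Suc.prems] pf[OF nz[OF Suc.prems], of "?b v (Suc n)"]
          by (simp add: add_divide_distrib diff_divide_distrib mult.commute del: of_nat_Suc)
      next
        case Y
        show ?thesis using IHY[OF Y Suc.prems]
          by (simp add: add_divide_distrib diff_divide_distrib mult.commute del: of_nat_Suc)
      qed
      moreover have e: "real (Suc N) - real (Suc (Suc n)) = real N - real (Suc n)" by simp
      ultimately show ?case using Suc strict_chain_sum_Y[of "Suc N" ?w "Suc n", unfolded e] strict_chain_sum_Y[of N ?w n]
        by (simp add: diff_divide_distrib add_divide_distrib del: of_nat_Suc)
    qed
    show ?case using X Y by blast
  qed
  then show "w \<noteq> [] \<Longrightarrow> n < N \<Longrightarrow>
      strict_chain_sum (Suc N) (X # w) n = strict_chain_sum N (X # w) n - strict_chain_sum N w n / N"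
    "n < N \<Longrightarrow> strict_chain_sum (Suc N) (Y # w) (Suc n) = strict_chain_sum N (Y # w) n + strict_chain_sum N w n / N"
    by blast+
qed

text \<open>For an additional \<open>x\<close>, the chains reaching Suc N have a factor 1/(N+1), and
  the part of them already present for N cancels the correction of the shift. So each
  \<open>x\<close> multiplies the increment by 1/(N+1), as raising the last entry of an index
  does.\<close>

lemma strict_chain_sum_step:
  assumes "w = [] \<or> last w = Y"
  shows "strict_chain_sum (Suc (Suc N)) (replicate j X @ Y # w) (Suc N) =
    strict_chain_sum (Suc N) (replicate j X @ Y # w) N + strict_chain_sum (Suc N) w N / real (Suc N) ^ Suc j"
proof (induction j)
  case 0
  then show ?case using strict_chain_sum_shift(2)[OF assms, of N "Suc N"] by simp
next
  case (Suc j)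
  let ?u = "replicate j X @ Y # w"
  have u: "?u = [] \<or> last ?u = Y" "?u \<noteq> []" using assms by auto
  have "strict_chain_sum (Suc (Suc N)) (X # ?u) (Suc N) = strict_chain_sum (Suc (Suc N)) (X # ?u) N
     + strict_chain_sum (Suc (Suc N)) ?u (Suc N) / real (Suc N)" by (rule strict_chain_sum_X)
  also have "strict_chain_sum (Suc (Suc N)) (X # ?u) N = strict_chain_sum (Suc N) (X # ?u) N - strict_chain_sum (Suc N) ?u N / real (Suc N)"
    by (rule strict_chain_sum_shift(1)[OF u]) simp
  finally show ?case using Suc by (simp add: add_divide_distrib mult.commute del: of_nat_Suc)
qed

text \<open>Index and word are both reversed, so the block yx^(k-1) of an entry k is read
  backwards.\<close>

definition index_word :: "nat list \<Rightarrow> letter list" where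
  "index_word ks = concat (map (\<lambda>k. replicate (k - 1) X @ [Y]) ks)"

lemma last_index_word: "index_word ks = [] \<or> last (index_word ks) = Y"
  by (induction ks) (auto simp: index_word_def)

lemma strict_chain_sum_eq_trunc_mzv:
  assumes "\<forall>k\<in>set ks. k > 0"
  shows "strict_chain_sum (Suc N) (index_word ks) N = trunc_mzv ks N"
  using assms
proof (induction ks arbitrary: N)
  case (Cons k ks)
  have w: "index_word (k # ks) = replicate (k - 1) X @ Y # index_word ks" by (simp add: index_word_def)
  show ?case
  proof (induction N)
    case 0
    then show ?case by (simp add: w strict_chain_sum_zero)
  next
    case (Suc N)
    have "Suc (k - 1) = k" using Cons.prems by simp
    then show ?case using strict_chain_sum_step[OF last_index_word, of N "k - 1" ks] Suc Cons
      unfolding w trunc_mzv_Suc by (simp del: of_nat_Suc trunc_mzv.simps)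
  qed
qed (simp add: index_word_def)

fun block_word :: "nat list \<Rightarrow> letter list" where
  "block_word [] = []"
| "block_word (b # cs) = replicate b (if even (length cs) then Y else X) @ block_word cs"

lemma lhs_index_snoc2:
  assumes "even (length c)"
  shows "lhs_index (c @ [a, b]) = lhs_index c @ replicate (a - 1) 1 @ [b + 1]"
proof -
  let ?g = "\<lambda>c j. replicate (c ! (2*j) - 1) 1 @ [c ! (2*j+1) + 1]"
  have m: "map (?g (c @ [a, b])) [0..<length c div 2] = map (?g c) [0..<length c div 2]"
    by (rule map_cong) (auto simp: nth_append)
  have len: "length (c @ [a, b]) div 2 = Suc (length c div 2)" by simp
  have "lhs_index (c @ [a, b]) = lhs_index c @ ?g (c @ [a, b]) (length c div 2)"
    by (simp only: lhs_index_def len upt_Suc le0 if_True map_append concat_append m) simp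
  moreover have "2 * (length c div 2) = length c" using assms by simp
  ultimately show ?thesis by (simp add: nth_append)
qed

text \<open>The entries ({1}^(a-1), b+1) spell y^(a-1) times yx^b, that is y^a x^b, so the left side
  of the theorem is Z of the word that c encodes.\<close>

lemma index_word_lhs_index:
  assumes "even (length c)" "\<forall>k\<in>set c. k > 0"
  shows "index_word (rev (lhs_index c)) = block_word (rev c) \<and> (\<forall>k\<in>set (lhs_index c). k > 0)"
  using assms
proof (induction c rule: parity_snoc2_induct)
  case Nil
  then show ?case by (simp add: lhs_index_def index_word_def)
next
  case (snoc2 c a b)
  have "concat (replicate n [Y]) = replicate n Y" for n by (induction n) auto
  moreover have "replicate a Y = Y # replicate (a - 1) Y" using snoc2.prems by (cases a) auto
  ultimately show ?case using snoc2
    by (auto simp: lhs_index_snoc2 index_word_def map_replicate replicate_app_Cons_same)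
qed

section \<open>Weak and strict chain sums have the same limit\<close>

text \<open>The summand 1 keeps the bound at least 1, so its powers increase with the
  exponent.\<close>

definition harm_bound :: "nat \<Rightarrow> real" where
  "harm_bound M = 1 + harm (M - 1)"

lemma harm_bound_ge_1: "harm_bound M \<ge> 1"
  by (simp add: harm_bound_def harm_nonneg)

lemma sum_inverse_le_harm_bound:
  assumes "n < M"
  shows "(\<Sum>m = 1..n. 1 / real m) \<le> harm_bound M" "(\<Sum>m = 1..n. 1 / (real M - real m)) \<le> harm_bound M"
proof -
  have h: "harm (M - 1) = (\<Sum>m = 1..M - 1. 1 / real m)" by (simp add: harm_def inverse_eq_divide)
  show "(\<Sum>m = 1..n. 1 / real m) \<le> harm_bound M"
    unfolding harm_bound_def h by (rule order_trans[OF sum_mono2[of "{1..M - 1}"]]) (use assms in auto)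
  have "(\<Sum>m = 1..n. 1 / (real M - real m)) = (\<Sum>m\<in>{M - n..M - 1}. 1 / real m)"
    by (rule sum.reindex_bij_witness[of _ "\<lambda>m. M - m" "\<lambda>m. M - m"]) (use assms in auto)
  also have "\<dots> \<le> (\<Sum>m = 1..M - 1. 1 / real m)" by (rule sum_mono2) (use assms in auto)
  finally show "(\<Sum>m = 1..n. 1 / (real M - real m)) \<le> harm_bound M" unfolding harm_bound_def h by simp
qed

text \<open>Telescoping: 1/x^2 <= 2/(x(x+1)) = 2/x - 2/(x+1) for x >= 1.\<close>

lemma sum_inverse_squares_le:
  assumes "n < M"
  shows "(\<Sum>m = 1..n. 1 / (real M - real m)^2) \<le> 2 / (real M - real n)"
  using assms
proof (induction n)
  case (Suc n)
  define x where "x = real M - real (Suc n)"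
  have x: "x \<ge> 1" using Suc.prems by (simp add: x_def)
  have "2 / (x + 1) + 1 / x^2 \<le> 2 / x"
  proof -
    have "2 / x - 2 / (x + 1) = 2 / (x * (x + 1))" using x by (simp add: field_simps)
    moreover have "2 / (2 * x^2) \<le> 2 / (x * (x + 1))"
    proof (rule frac_le)
      show "0 < x * (x + 1)" using x by (intro mult_pos_pos) auto
      show "x * (x + 1) \<le> 2 * x^2" using x by (simp add: power2_eq_square algebra_simps)
    qed auto
    ultimately show ?thesis by simp
  qed
  moreover have "real M - real n = x + 1" by (simp add: x_def)
  ultimately show ?case using Suc by (simp add: x_def[symmetric] del: of_nat_Suc)
qed simp

lemma chain_sum_bounds:
  assumes "n < M"
  shows "0 \<le> chain_sum M cs n \<and> chain_sum M cs n \<le> harm_bound M ^ sum_list cs"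
  using assms
proof (induction M cs n rule: chain_sum.induct)
  case (3 M b cs n)
  let ?w = "\<lambda>m. if even (length cs) then 1 / (real M - real m) else 1 / real m"
  have w: "?w m \<ge> 0" if "m \<in> {1..n}" for m using that 3 by auto
  have IH: "0 \<le> chain_sum M (b # cs) m" "chain_sum M (b # cs) m \<le> harm_bound M ^ sum_list (b # cs)" if "m \<in> {1..n}" for m
    using 3(1)[OF that] that 3(2) by auto
  have "chain_sum M (Suc b # cs) n \<le> (\<Sum>m = 1..n. ?w m * harm_bound M ^ sum_list (b # cs))"
    unfolding chain_sum.simps by (intro sum_mono mult_left_mono IH w)
  also have "\<dots> = (\<Sum>m = 1..n. ?w m) * harm_bound M ^ sum_list (b # cs)" by (simp add: sum_distrib_right)
  also have "\<dots> \<le> harm_bound M * harm_bound M ^ sum_list (b # cs)"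
    using sum_inverse_le_harm_bound[OF 3(2)] harm_bound_ge_1[of M] by (intro mult_right_mono; cases "even (length cs)") auto
  finally show ?case using IH w unfolding chain_sum.simps by (auto intro!: sum_nonneg mult_nonneg_nonneg)
qed auto

text \<open>One more \<open>y\<close> preserves an error of shape 1/(M-n) without a logarithm, since
  the squares of its weights telescope. The 2 in the hypothesis leaves room for two errors of size
  C.\<close>

lemma chain_diff_y:
  fixes u v :: "nat \<Rightarrow> real"
  assumes C: "C \<ge> 0" and n: "n < M"
    and d: "\<And>m. m \<in> {1..n} \<Longrightarrow> \<bar>u m - v m\<bar> \<le> 2 * C / (real M - real m)"
  shows "\<bar>(\<Sum>m = 1..n. 1 / (real M - real m) * u m) - (\<Sum>m = 1..n. 1 / (real M - real m) * v m)\<bar>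
    \<le> 4 * C / (real M - real n)"
proof -
  have "\<bar>(\<Sum>m = 1..n. 1 / (real M - real m) * u m) - (\<Sum>m = 1..n. 1 / (real M - real m) * v m)\<bar>
    = \<bar>\<Sum>m = 1..n. 1 / (real M - real m) * (u m - v m)\<bar>"
    by (simp add: sum_subtractf diff_divide_distrib)
  also have "\<dots> \<le> (\<Sum>m = 1..n. \<bar>1 / (real M - real m) * (u m - v m)\<bar>)" by (rule sum_abs)
  also have "\<dots> \<le> (\<Sum>m = 1..n. 2 * C * (1 / (real M - real m)^2))"
  proof (rule sum_mono)
    fix m assume m: "m \<in> {1..n}"
    then have p: "real M - real m > 0" using n by auto
    have "\<bar>1 / (real M - real m) * (u m - v m)\<bar> = 1 / (real M - real m) * \<bar>u m - v m\<bar>"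
      using p by (simp add: abs_mult)
    also have "\<dots> \<le> 1 / (real M - real m) * (2 * C / (real M - real m))"
      using p d[OF m] by (intro mult_left_mono) auto
    finally show "\<bar>1 / (real M - real m) * (u m - v m)\<bar> \<le> 2 * C * (1 / (real M - real m)^2)"
      by (simp add: power2_eq_square)
  qed
  also have "\<dots> = 2 * C * (\<Sum>m = 1..n. 1 / (real M - real m)^2)" by (simp only: sum_distrib_left)
  also have "\<dots> \<le> 2 * C * (2 / (real M - real n))"
    using C sum_inverse_squares_le[OF n] by (intro mult_left_mono) auto
  finally show ?thesis by simp
qed

text \<open>One more \<open>x\<close> turns the error C/(M-m) into a uniform O(C log M / M), by
  partial fractions of 1/(m(M-m)). This is the source of the decay.\<close>

lemma chain_diff_x:
  fixes u v :: "nat \<Rightarrow> real"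
  assumes C: "C \<ge> 0" and n: "n < M"
    and d: "\<And>m. m \<in> {1..n} \<Longrightarrow> \<bar>u m - v m\<bar> \<le> C / (real M - real m)"
  shows "\<bar>(\<Sum>m = 1..n. 1 / real m * u m) - (\<Sum>m = 1..n. 1 / real m * v m)\<bar> \<le> 4 * harm_bound M * C / real M"
proof -
  have "\<bar>(\<Sum>m = 1..n. 1 / real m * u m) - (\<Sum>m = 1..n. 1 / real m * v m)\<bar>
    = \<bar>\<Sum>m = 1..n. 1 / real m * (u m - v m)\<bar>"
    by (simp add: sum_subtractf diff_divide_distrib)
  also have "\<dots> \<le> (\<Sum>m = 1..n. \<bar>1 / real m * (u m - v m)\<bar>)" by (rule sum_abs)
  also have "\<dots> \<le> (\<Sum>m = 1..n. C / real M * (1 / real m + 1 / (real M - real m)))"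
  proof (rule sum_mono)
    fix m assume m: "m \<in> {1..n}"
    then have p: "real M - real m > 0" "real m > 0" "real M > 0" using n by auto
    have "\<bar>1 / real m * (u m - v m)\<bar> = 1 / real m * \<bar>u m - v m\<bar>"
      using p by (simp add: abs_mult)
    also have "\<dots> \<le> 1 / real m * (C / (real M - real m))"
      using p d[OF m] by (intro mult_left_mono) auto
    also have "\<dots> = C / real M * (1 / real m + 1 / (real M - real m))"
      using p by (simp add: divide_simps)
    finally show "\<bar>1 / real m * (u m - v m)\<bar> \<le> C / real M * (1 / real m + 1 / (real M - real m))" .
  qed
  also have "\<dots> = C / real M * ((\<Sum>m = 1..n. 1 / real m) + (\<Sum>m = 1..n. 1 / (real M - real m)))"
    by (simp only: sum_distrib_left[symmetric] sum.distrib)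
  also have "\<dots> \<le> C / real M * (harm_bound M + harm_bound M)"
    using C sum_inverse_le_harm_bound[OF n] by (intro mult_left_mono add_mono) auto
  also have "\<dots> \<le> 4 * harm_bound M * C / real M"
    using C harm_bound_ge_1[of M] by (simp add: field_simps divide_right_mono)
  finally show ?thesis .
qed

lemma strict_chain_sum_x_sum:
  assumes "odd (length cs)"
  shows "strict_chain_sum M (block_word (Suc b # cs)) n =
    (\<Sum>m = 1..n. 1 / real m * strict_chain_sum M (block_word (b # cs)) m)"
  using assms by (simp add: strict_chain_sum.simps)

lemma strict_chain_sum_y_sum:
  assumes "even (length cs)"
  shows "strict_chain_sum M (block_word (Suc b # cs)) n =
    (\<Sum>m = 1..n. 1 / (real M - real m) * strict_chain_sum M (block_word (b # cs)) (m - 1))"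
  using assms by (simp add: strict_chain_sum.simps)

lemma chain_sum_diff_x:
  assumes "odd (length cs)" "n < M"
    and "\<And>m. m < M \<Longrightarrow> \<bar>chain_sum M (b # cs) m - strict_chain_sum M (block_word (b # cs)) m\<bar>
      \<le> (4 * harm_bound M) ^ sum_list (b # cs) / (real M - real m)"
  shows "\<bar>chain_sum M (Suc b # cs) n - strict_chain_sum M (block_word (Suc b # cs)) n\<bar>
    \<le> (4 * harm_bound M) ^ sum_list (Suc b # cs) / real M"
proof -
  have "chain_sum M (Suc b # cs) n = (\<Sum>m = 1..n. 1 / real m * chain_sum M (b # cs) m)" using assms(1) by simp
  then show ?thesis using chain_diff_x[of "(4 * harm_bound M) ^ sum_list (b # cs)" n M "chain_sum M (b # cs)"
      "strict_chain_sum M (block_word (b # cs))"] assms(2,3) harm_bound_ge_1[of M]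
    unfolding strict_chain_sum_x_sum[OF assms(1)] by (simp add: mult.assoc)
qed

text \<open>The bound may grow as n approaches M: at n = M - 1 it is only a power of a logarithm,
  and smallness comes from a final \<open>x\<close> through \<open>chain_sum_diff_x\<close>. Each
  letter costs a factor 4 * \<open>harm_bound M\<close>.\<close>

lemma chain_sum_diff:
  assumes "n < M" "\<forall>k\<in>set cs. k > 0"
  shows "\<bar>chain_sum M cs n - strict_chain_sum M (block_word cs) n\<bar> \<le> (4 * harm_bound M) ^ sum_list cs / (real M - real n)"
  using assms
proof (induction cs arbitrary: n)
  case (Cons k cs)
  have L4: "4 * harm_bound M \<ge> 1" using harm_bound_ge_1[of M] by simp
  have IH: "\<bar>chain_sum M cs m - strict_chain_sum M (block_word cs) m\<bar> \<le> (4 * harm_bound M) ^ sum_list cs / (real M - real m)"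
    if "m < M" for m using Cons that by simp
  show ?case
  proof (cases "even (length cs)")
    case False
    have "\<bar>chain_sum M (b # cs) n - strict_chain_sum M (block_word (b # cs)) n\<bar>
        \<le> (4 * harm_bound M) ^ sum_list (b # cs) / (real M - real n)" if "n < M" for b n
      using that
    proof (induction b arbitrary: n)
      case 0
      then show ?case using IH[of n] False by simp
    next
      case (Suc b)
      have "\<bar>chain_sum M (Suc b # cs) n - strict_chain_sum M (block_word (Suc b # cs)) n\<bar>
          \<le> (4 * harm_bound M) ^ sum_list (Suc b # cs) / real M"
        by (rule chain_sum_diff_x[OF False Suc.prems Suc.IH])
      also have "\<dots> \<le> (4 * harm_bound M) ^ sum_list (Suc b # cs) / (real M - real n)"
        using Suc.prems L4 by (intro divide_left_mono) auto
      finally show ?case .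
    qed
    then show ?thesis using Cons.prems by blast
  next
    case True
    have sum: "chain_sum M (Suc b # cs) n = (\<Sum>m = 1..n. 1 / (real M - real m) * chain_sum M (b # cs) m)" for b n
      using True by simp
    have step: "\<bar>chain_sum M (Suc b # cs) n - strict_chain_sum M (block_word (Suc b # cs)) n\<bar>
        \<le> (4 * harm_bound M) ^ sum_list (Suc b # cs) / (real M - real n)"
      if n: "n < M" and d: "\<And>m. m \<in> {1..n} \<Longrightarrow>
         \<bar>chain_sum M (b # cs) m - strict_chain_sum M (block_word (b # cs)) (m - 1)\<bar>
          \<le> 2 * (4 * harm_bound M) ^ sum_list (b # cs) / (real M - real m)" for b n
    proof -
      have "\<bar>chain_sum M (Suc b # cs) n - strict_chain_sum M (block_word (Suc b # cs)) n\<bar>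
          \<le> 4 * (4 * harm_bound M) ^ sum_list (b # cs) / (real M - real n)"
        unfolding sum strict_chain_sum_y_sum[OF True] by (rule chain_diff_y[OF _ n d]) (use L4 in auto)
      also have "\<dots> \<le> (4 * harm_bound M) * (4 * harm_bound M) ^ sum_list (b # cs) / (real M - real n)"
        using n harm_bound_ge_1[of M] by (intro divide_right_mono mult_right_mono) auto
      finally show ?thesis by simp
    qed
    have "\<bar>chain_sum M (Suc b # cs) n - strict_chain_sum M (block_word (Suc b # cs)) n\<bar>
        \<le> (4 * harm_bound M) ^ sum_list (Suc b # cs) / (real M - real n)" if "n < M" for b n
      using that
    proof (induction b arbitrary: n)
      case 0
      show ?case
      proof (rule step[OF 0])
        \<comment> \<open>Below an exhausted \<open>y\<close>-block the weak sum drops to m - 1 as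
          well, so no new error arises.\<close>
        fix m assume m: "m \<in> {1..n}"
        then have "m - 1 < M" using 0 by auto
        have "\<bar>chain_sum M (0 # cs) m - strict_chain_sum M (block_word (0 # cs)) (m - 1)\<bar>
            \<le> (4 * harm_bound M) ^ sum_list cs / (real M - real (m - 1))"
          using IH[OF \<open>m - 1 < M\<close>] True by simp
        also have "\<dots> \<le> 2 * (4 * harm_bound M) ^ sum_list cs / (real M - real m)"
          using m 0 L4 by (intro frac_le) auto
        finally show "\<bar>chain_sum M (0 # cs) m - strict_chain_sum M (block_word (0 # cs)) (m - 1)\<bar>
          \<le> 2 * (4 * harm_bound M) ^ sum_list (0 # cs) / (real M - real m)" by simp
      qed
    next
      case (Suc b)
      show ?case
      proof (rule step[OF Suc.prems])
        fix m assume m: "m \<in> {1..n}"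
        then obtain m' where m': "m = Suc m'" by (cases m) auto
        have pos: "real M - real m > 0" using m Suc.prems by auto
        let ?C = "(4 * harm_bound M) ^ sum_list (Suc b # cs)"
        \<comment> \<open>Inside a \<open>y\<close>-block the weak sum is taken at m and the strict
          one at m - 1; the additional chains have top entry m and hence a factor 1/(M-m).\<close>
        have "chain_sum M (Suc b # cs) m - chain_sum M (Suc b # cs) m' = chain_sum M (b # cs) m / (real M - real m)"
          using chain_sum_y[OF True, of "Suc b" M m'] by (simp add: m' del: of_nat_Suc chain_sum.simps)
        moreover have "0 \<le> chain_sum M (b # cs) m" "chain_sum M (b # cs) m \<le> ?C"
        proof -
          have "chain_sum M (b # cs) m \<le> harm_bound M ^ sum_list (b # cs)" using chain_sum_bounds[of m M "b # cs"] m Suc.prems by simp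
          also have "\<dots> \<le> (4 * harm_bound M) ^ sum_list (b # cs)" using harm_bound_ge_1[of M] by (intro power_mono) auto
          also have "\<dots> \<le> ?C" using L4 by (intro power_increasing) auto
          finally show "chain_sum M (b # cs) m \<le> ?C" .
          show "0 \<le> chain_sum M (b # cs) m" using chain_sum_bounds[of m M "b # cs"] m Suc.prems by simp
        qed
        ultimately have 1: "\<bar>chain_sum M (Suc b # cs) m - chain_sum M (Suc b # cs) m'\<bar> \<le> ?C / (real M - real m)"
          using pos by (simp add: divide_right_mono del: chain_sum.simps)
        have "\<bar>chain_sum M (Suc b # cs) m' - strict_chain_sum M (block_word (Suc b # cs)) m'\<bar> \<le> ?C / (real M - real m')"
          using m Suc.prems by (intro Suc.IH) (simp add: m')
        also have "\<dots> \<le> ?C / (real M - real m)"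
          using pos L4 by (intro divide_left_mono) (auto simp: m')
        finally show "\<bar>chain_sum M (Suc b # cs) m - strict_chain_sum M (block_word (Suc b # cs)) (m - 1)\<bar>
          \<le> 2 * ?C / (real M - real m)"
          using 1 by (simp add: m' del: chain_sum.simps of_nat_Suc block_word.simps sum_list.Cons)
      qed
    qed
    from this[of n "k - 1"] show ?thesis using Cons.prems by simp
  qed
qed simp

lemma harm_bound_power_over_n: "(\<lambda>N. (4 * harm_bound (Suc N)) ^ s / real (Suc N)) \<longlonglongrightarrow> 0"
proof -
  \<comment> \<open>\<open>harm_bound (Suc N)\<close> is at most 1 + (1 + ln (N+1)), and exp (2 + ln
    (N+1)) is e^2 (N+1), so the claim becomes the decay of x^s / exp x.\<close>
  let ?x = "\<lambda>N. 2 + ln (real (Suc N))"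
  have lim: "filterlim ?x at_top sequentially"
    by (intro filterlim_tendsto_add_at_top[OF tendsto_const]
      filterlim_compose[OF ln_at_top] filterlim_compose[OF filterlim_real_sequentially] filterlim_Suc)
  have "(\<lambda>N. 4 ^ s * exp 2 * (?x N ^ s / exp (?x N))) \<longlonglongrightarrow> 4 ^ s * exp 2 * 0"
    by (intro tendsto_mult tendsto_const filterlim_compose[OF tendsto_power_div_exp_0 lim])
  then have lim0: "(\<lambda>N. 4 ^ s * exp 2 * (?x N ^ s / exp (?x N))) \<longlonglongrightarrow> 0" by simp
  have lower: "0 \<le> (4 * harm_bound (Suc N)) ^ s / real (Suc N)" for N using harm_bound_ge_1[of "Suc N"] by auto
  have upper: "(4 * harm_bound (Suc N)) ^ s / real (Suc N) \<le> 4 ^ s * exp 2 * (?x N ^ s / exp (?x N))" for N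
  proof -
    have "harm N \<le> 1 + ln (real (Suc N))"
    proof (cases "N = 0")
      case False
      then have "harm N - ln (real N) \<le> harm 1 - ln (real 1)"
        using euler_mascheroni_sequence_decreasing[of 1 N] by simp
      moreover have "ln (real N) \<le> ln (real (Suc N))" using False by simp
      ultimately show ?thesis by (simp add: harm_def)
    qed (simp add: harm_def)
    then have "harm_bound (Suc N) \<le> ?x N" by (simp add: harm_bound_def)
    then have "(4 * harm_bound (Suc N)) ^ s \<le> (4 * ?x N) ^ s" using harm_bound_ge_1[of "Suc N"] by (intro power_mono) auto
    then have "(4 * harm_bound (Suc N)) ^ s / real (Suc N) \<le> (4 * ?x N) ^ s / real (Suc N)" by (intro divide_right_mono) auto
    also have "\<dots> = 4 ^ s * exp 2 * (?x N ^ s / exp (?x N))"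
      unfolding power_mult_distrib exp_add by (simp del: of_nat_Suc)
    finally show ?thesis .
  qed
  show ?thesis
    by (rule tendsto_sandwich[OF _ _ tendsto_const lim0]) (use lower upper in auto)
qed

section \<open>Passage to the limit\<close>

definition tuples :: "nat list \<Rightarrow> nat list set" where
  "tuples ks = {ns. length ns = length ks \<and> sorted_wrt (<) ns \<and> (\<forall>n\<in>set ns. 0 < n)}"

definition summand :: "nat list \<Rightarrow> nat list \<Rightarrow> real" where
  "summand ks ns = (\<Prod>i<length ks. 1 / real (ns ! i) ^ (ks ! i))"

definition tuples_le :: "nat list \<Rightarrow> nat \<Rightarrow> nat list set" where
  "tuples_le ks N = {ns \<in> tuples ks. \<forall>n\<in>set ns. n \<le> N}"

lemma finite_tuples_le: "finite (tuples_le ks N)"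
  by (rule finite_subset[OF _ finite_lists_length_eq[of "{..N}" "length ks"]])
    (auto simp: tuples_le_def tuples_def)

lemma tuples_le_snoc:
  "tuples_le (ks @ [k]) N = (\<lambda>(n, ns). ns @ [n]) ` (SIGMA n:{1..N}. tuples_le ks (n - 1))"
proof (intro equalityI subsetI)
  fix ms assume ms: "ms \<in> tuples_le (ks @ [k]) N"
  then have "ms \<noteq> []" by (auto simp: tuples_le_def tuples_def)
  then obtain ns n where e: "ms = ns @ [n]" by (metis rev_exhaust)
  have "ns \<in> tuples_le ks (n - 1)" "n \<in> {1..N}"
    using ms by (fastforce simp: tuples_le_def tuples_def e sorted_wrt_append)+
  then show "ms \<in> (\<lambda>(n, ns). ns @ [n]) ` (SIGMA n:{1..N}. tuples_le ks (n - 1))"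
    unfolding e by force
qed (fastforce simp: tuples_le_def tuples_def sorted_wrt_append)

lemma sum_tuples_le: "(\<Sum>ns\<in>tuples_le ks N. summand ks ns) = trunc_mzv (rev ks) N"
proof (induction ks arbitrary: N rule: rev_induct)
  case Nil
  have "tuples_le [] N = {[]}" by (auto simp: tuples_le_def tuples_def)
  then show ?case by (simp add: summand_def)
next
  case (snoc k ks)
  have s: "summand (ks @ [k]) (ns @ [n]) = summand ks ns / real n ^ k" if "ns \<in> tuples_le ks m" for ns n m
  proof -
    have l: "length ns = length ks" using that by (simp add: tuples_le_def tuples_def)
    have "(\<Prod>i<length ks. 1 / real ((ns @ [n]) ! i) ^ ((ks @ [k]) ! i)) = summand ks ns"
      unfolding summand_def by (rule prod.cong) (auto simp: nth_append l)
    then show ?thesis by (simp add: summand_def l nth_append)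
  qed
  have "(\<Sum>ns\<in>tuples_le (ks @ [k]) N. summand (ks @ [k]) ns)
    = (\<Sum>(n, ns)\<in>(SIGMA n:{1..N}. tuples_le ks (n - 1)). summand (ks @ [k]) (ns @ [n]))"
    unfolding tuples_le_snoc by (subst sum.reindex) (auto simp: inj_on_def case_prod_beta)
  also have "\<dots> = (\<Sum>n = 1..N. \<Sum>ns\<in>tuples_le ks (n - 1). summand (ks @ [k]) (ns @ [n]))"
    by (rule sum.Sigma[symmetric]) (auto simp: finite_tuples_le)
  also have "\<dots> = (\<Sum>n = 1..N. trunc_mzv (rev ks) (n - 1) / real n ^ k)"
    by (rule sum.cong) (simp_all add: s snoc.IH[symmetric] sum_divide_distrib)
  finally show ?case by simp
qed

text \<open>\<open>infsum\<close> defaults to 0 on families that are not summable, so summability is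
  extracted from the assumed limit: the summands are nonnegative, and l bounds all finite partial
  sums.\<close>

lemma mzv_eq_limit:
  assumes "(\<lambda>N. trunc_mzv (rev ks) N) \<longlonglongrightarrow> l"
  shows "mzv ks = l"
proof -
  have ex: "\<forall>\<^sub>F N in sequentially. F \<subseteq> tuples_le ks N" if "finite F" "F \<subseteq> tuples ks" for F
  proof -
    have "finite (\<Union>(set ` F))" using that by auto
    then obtain N0 where "\<forall>n\<in>\<Union>(set ` F). n \<le> N0" using finite_nat_set_iff_bounded_le by blast
    then show ?thesis using that(2) by (intro eventually_sequentiallyI[of N0]) (fastforce simp: tuples_le_def)
  qed
  have filt: "filterlim (tuples_le ks) (finite_subsets_at_top (tuples ks)) sequentially"
    unfolding filterlim_finite_subsets_at_top
  proof (intro allI impI)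
    fix F assume "finite F \<and> F \<subseteq> tuples ks"
    then have "\<forall>\<^sub>F N in sequentially. F \<subseteq> tuples_le ks N" using ex by blast
    then show "\<forall>\<^sub>F N in sequentially. finite (tuples_le ks N) \<and> F \<subseteq> tuples_le ks N \<and> tuples_le ks N \<subseteq> tuples ks"
      by eventually_elim (simp add: finite_tuples_le, auto simp: tuples_le_def)
  qed
  have nonneg: "summand ks ns \<ge> 0" for ns by (simp add: summand_def prod_nonneg)
  have "summand ks summable_on tuples ks"
  proof (rule nonneg_bdd_above_summable_on)
    show "bdd_above (sum (summand ks) ` {F. F \<subseteq> tuples ks \<and> finite F})"
    proof (rule bdd_aboveI2)
      fix F assume F: "F \<in> {F. F \<subseteq> tuples ks \<and> finite F}"
      have "\<forall>\<^sub>F N in sequentially. F \<subseteq> tuples_le ks N" using F ex by blast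
      then have "\<forall>\<^sub>F N in sequentially. sum (summand ks) F \<le> trunc_mzv (rev ks) N"
        by eventually_elim (use nonneg in \<open>auto simp: sum_tuples_le[symmetric] finite_tuples_le intro!: sum_mono2\<close>)
      then show "sum (summand ks) F \<le> l" by (rule tendsto_lowerbound[OF assms]) simp
    qed
  qed (rule nonneg)
  then have "(summand ks has_sum infsum (summand ks) (tuples ks)) (tuples ks)" by (rule has_sum_infsum)
  then have "(\<lambda>N. trunc_mzv (rev ks) N) \<longlonglongrightarrow> infsum (summand ks) (tuples ks)"
    unfolding has_sum_def sum_tuples_le[symmetric] by (rule filterlim_compose[OF _ filt])
  then have "infsum (summand ks) (tuples ks) = l" using assms LIMSEQ_unique by blast
  moreover have "mzv ks = infsum (summand ks) (tuples ks)"
    unfolding mzv_def tuples_def by (rule arg_cong2[where f = infsum]) (auto simp: summand_def fun_eq_iff)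
  ultimately show ?thesis by simp
qed

section \<open>Convergence for indices with all entries at least 2\<close>

lemma trunc_mzv_nonneg: "trunc_mzv ks N \<ge> 0"
  by (induction ks N rule: trunc_mzv.induct) (auto intro!: sum_nonneg)

text \<open>Dropping the nesting bounds the sum by a product, in which each entry contributes at
  most the sum of 1/n^2, itself at most 2.\<close>

lemma trunc_mzv_le:
  assumes "\<forall>k\<in>set ks. 2 \<le> k"
  shows "trunc_mzv ks N \<le> 2 ^ length ks"
  using assms
proof (induction ks arbitrary: N)
  case (Cons k ks)
  have "trunc_mzv (k # ks) N \<le> (\<Sum>n = 1..N. 2 ^ length ks * (1 / real n ^ 2))"
    unfolding trunc_mzv.simps
  proof (rule sum_mono)
    fix n assume n: "n \<in> {1..N}"
    have "trunc_mzv ks (n - 1) / real n ^ k \<le> 2 ^ length ks / real n ^ 2"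
      using Cons n trunc_mzv_nonneg by (intro frac_le power_increasing) auto
    then show "trunc_mzv ks (n - 1) / real n ^ k \<le> 2 ^ length ks * (1 / real n ^ 2)" by simp
  qed
  also have "\<dots> = 2 ^ length ks * (\<Sum>n = 1..N. 1 / real n ^ 2)" by (simp only: sum_distrib_left)
  also have "(\<Sum>n = 1..N. 1 / real n ^ 2) \<le> 2"
  proof -
    \<comment> \<open>Reversing the order of summation gives the form of
      \<open>sum_inverse_squares_le\<close> with M - n = 1.\<close>
    have "(\<Sum>n = 1..N. 1 / real n ^ 2) = (\<Sum>m = 1..N. 1 / (real (Suc N) - real m) ^ 2)"
      by (rule sum.reindex_bij_witness[of _ "\<lambda>m. Suc N - m" "\<lambda>m. Suc N - m"]) (auto simp: of_nat_diff)
    also have "\<dots> \<le> 2" using sum_inverse_squares_le[of N "Suc N"] by simp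
    finally show ?thesis .
  qed
  finally show ?case by simp
qed simp

lemma trunc_mzv_convergent:
  assumes "\<forall>k\<in>set ks. 2 \<le> k"
  shows "convergent (trunc_mzv ks)"
proof (rule Bseq_mono_convergent)
  show "Bseq (trunc_mzv ks)"
    using trunc_mzv_le[OF assms] trunc_mzv_nonneg by (intro BseqI'[of _ "2 ^ length ks"]) simp
  show "\<forall>m n. m \<le> n \<longrightarrow> trunc_mzv ks m \<le> trunc_mzv ks n"
    by (cases ks) (auto intro!: sum_mono2 divide_nonneg_nonneg trunc_mzv_nonneg)
qed

lemma trunc_Zword_tendsto:
  assumes "ge2_word w"
  shows "(\<lambda>N. trunc_Zword N w) \<longlonglongrightarrow> Zword w"
proof (cases "w = []")
  case False
  then have w: "hd w = Y" "last w = X" "\<forall>k\<in>set (rev (decode w)). 2 \<le> k" using assms by (auto simp: ge2_word_def)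
  obtain l where "trunc_mzv (rev (decode w)) \<longlonglongrightarrow> l" using trunc_mzv_convergent[OF w(3)] by (auto simp: convergent_def)
  then show ?thesis using mzv_eq_limit[of "decode w" l] w False by (simp add: trunc_Zword_def Zword_def)
qed (simp add: trunc_Zword_def Zword_def)

theorem mainTheorem2:
  fixes s :: nat and c :: "nat list"
  assumes "s \<ge> 1" and "length c = 2 * s" and "\<forall>k\<in>set c. k > 0"
  shows "mzv (lhs_index c) = Zpoly (fD c)"
proof (rule mzv_eq_limit)
  have even: "even (length c)" using assms(2) by simp
  have supp: "ge2_word w" if "fD c w \<noteq> 0" for w
    using supp_Dfuel[OF even] that unfolding fD_def by blast
  have lhs: "trunc_mzv (rev (lhs_index c)) N = strict_chain_sum (Suc N) (block_word (rev c)) N" for N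
    using index_word_lhs_index[OF even assms(3)] strict_chain_sum_eq_trunc_mzv[of "rev (lhs_index c)" N] by simp
  have rhs: "lin_eval (trunc_Zword N) (fD c) = chain_sum (Suc N) (rev c) N" for N
    unfolding fD_def by (rule lin_eval_trunc_Zword_Dfuel[OF even assms(3)]) simp
  \<comment> \<open>All words of the support have entries at least 2, so their truncations converge
    to \<open>Zword\<close>. Together with the vanishing difference below, this also yields
    convergence of the left-hand truncations.\<close>
  have "(\<lambda>N. lin_eval (trunc_Zword N) (fD c)) \<longlonglongrightarrow> Zpoly (fD c)"
    unfolding lin_eval_def Zpoly_def by (intro tendsto_sum tendsto_mult tendsto_const trunc_Zword_tendsto) (auto intro: supp)
  moreover have "(\<lambda>N. chain_sum (Suc N) (rev c) N - strict_chain_sum (Suc N) (block_word (rev c)) N) \<longlonglongrightarrow> 0"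
  proof -
    \<comment> \<open>The last block consists of letters \<open>x\<close>; its topmost letter is
      split off so that \<open>chain_sum_diff_x\<close> supplies the factor 1/M. If k = 1 the rest
      of the block is empty, and \<open>chain_sum_diff\<close> is applied to
      \<open>rev d\<close>.\<close>
    obtain d k where d: "c = d @ [k]" using assms(1,2) by (cases c rule: rev_cases) auto
    define b where "b = k - 1"
    have r: "rev c = Suc b # rev d" and odd: "odd (length (rev d))" and pos: "\<forall>k\<in>set (rev d). k > 0"
      using d assms(3) even by (auto simp: b_def)
    have diff: "\<bar>chain_sum M (b # rev d) m - strict_chain_sum M (block_word (b # rev d)) m\<bar>
      \<le> (4 * harm_bound M) ^ sum_list (b # rev d) / (real M - real m)" if "m < M" for M m
      using chain_sum_diff[OF that, of "b # rev d"] chain_sum_diff[OF that pos] pos odd by (cases "b = 0") auto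
    have "\<bar>chain_sum (Suc N) (rev c) N - strict_chain_sum (Suc N) (block_word (rev c)) N\<bar>
      \<le> (4 * harm_bound (Suc N)) ^ sum_list (rev c) / real (Suc N)" for N
      unfolding r by (rule chain_sum_diff_x[OF odd lessI diff])
    then show ?thesis
      by (intro Lim_null_comparison[OF _ harm_bound_power_over_n[of "sum_list (rev c)"]] always_eventually) auto
  qed
  ultimately have "(\<lambda>N. lin_eval (trunc_Zword N) (fD c) - (chain_sum (Suc N) (rev c) N - strict_chain_sum (Suc N) (block_word (rev c)) N))
      \<longlonglongrightarrow> Zpoly (fD c) - 0"
    by (rule tendsto_diff)
  then show "(\<lambda>N. trunc_mzv (rev (lhs_index c)) N) \<longlonglongrightarrow> Zpoly (fD c)" by (simp add: rhs lhs)
qed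

end
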